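(* Let $(M^{2n},J)$, $n\geq 2$, be a Kaehler manifold of real dimension $2n$ that at some point possesses positive holomorphic sectional curvature, that is, there is $x\in M^{2n}$ such that the sectional curvature satisfies $K(S,JS)>0$ for every $0\neq S\in T_xM$. Then $M^{2n}$ cannot be isometrically immersed in $\mathbb{H}^{3n-1}$.
   Context: A Kaehler manifold $(M^{2n},J)$ is a Riemannian manifold of real dimension $2n$ with an orthogonal almost complex structure $J$ that is parallel with respect to the Levi-Civita connection. $K(S,JS)$ is the sectional curvature of the plane spanned by $S$ and $JS$. $\mathbb{H}^{N}$ is the hyperbolic space of dimension $N$ and constant sectional curvature $-1$. *)

theory Defs
  imports "HOL-Analysis.Analysis"
begin

section \<open>Smooth functions between Euclidean spaces\<close>

text \<open>The set \<open>S\<close> is meant to be open; directional derivatives in all fixed directions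
  then determine the higher Frechet derivatives.\<close>

primrec Ck_on :: "nat \<Rightarrow> 'e::euclidean_space set \<Rightarrow> ('e \<Rightarrow> 'f::real_normed_vector) \<Rightarrow> bool"
  where
    "Ck_on 0 S f \<longleftrightarrow> continuous_on S f"
  | "Ck_on (Suc k) S f \<longleftrightarrow> (\<forall>x\<in>S. f differentiable (at x)) \<and>
       (\<forall>v. Ck_on k S (\<lambda>x. frechet_derivative f (at x) v))"

definition smooth_on :: "'e::euclidean_space set \<Rightarrow> ('e \<Rightarrow> 'f::real_normed_vector) \<Rightarrow> bool"
  where "smooth_on S f \<longleftrightarrow> (\<forall>k. Ck_on k S f)"


section \<open>Smooth manifolds and tangent vectors\<close>

text \<open>A chart is a pair of its domain and its coordinate map. A tangent vector at \<open>p\<close> is the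
  family of its coordinate vectors with respect to all charts around \<open>p\<close>, related by the
  differentials of the coordinate changes, and extended by \<open>0\<close> to all other pairs, so that equality
  of tangent vectors is equality of functions. The vector space operations are pointwise.\<close>

type_synonym ('a, 'e) chart = "'a set \<times> ('a \<Rightarrow> 'e)"
type_synonym ('a, 'e) tangent = "('a, 'e) chart \<Rightarrow> 'e"

record ('a, 'e) riemannian =
  mtop :: "'a topology"
  atlas :: "('a, 'e) chart set"
  metric :: "'a \<Rightarrow> ('a, 'e) tangent \<Rightarrow> ('a, 'e) tangent \<Rightarrow> real"

definition param :: "('a, 'e) chart \<Rightarrow> 'e \<Rightarrow> 'a"
  where "param c = inv_into (fst c) (snd c)"

definition charts_at :: "('a, 'e) riemannian \<Rightarrow> 'a \<Rightarrow> ('a, 'e) chart set"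
  where "charts_at M p = {c \<in> atlas M. p \<in> fst c}"

definition smooth_manifold :: "('a, 'e::euclidean_space) riemannian \<Rightarrow> bool"
  where "smooth_manifold M \<longleftrightarrow>
    Hausdorff_space (mtop M) \<and> second_countable (mtop M) \<and>
    (\<Union>c\<in>atlas M. fst c) = topspace (mtop M) \<and>
    (\<forall>c\<in>atlas M. openin (mtop M) (fst c) \<and> open (snd c ` fst c) \<and>
       homeomorphic_map (subtopology (mtop M) (fst c)) (top_of_set (snd c ` fst c)) (snd c)) \<and>
    (\<forall>c\<in>atlas M. \<forall>d\<in>atlas M. smooth_on (snd c ` (fst c \<inter> fst d)) (snd d \<circ> param c))"

definition tangent_space :: "('a, 'e::euclidean_space) riemannian \<Rightarrow> 'a \<Rightarrow> ('a, 'e) tangent set"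
  where "tangent_space M p = {v.
    (\<forall>c\<in>charts_at M p. \<forall>d\<in>charts_at M p.
       v d = frechet_derivative (snd d \<circ> param c) (at (snd c p)) (v c)) \<and>
    (\<forall>c. c \<notin> charts_at M p \<longrightarrow> v c = 0)}"

definition coord_vector ::
    "('a, 'e::euclidean_space) riemannian \<Rightarrow> ('a, 'e) chart \<Rightarrow> 'a \<Rightarrow> 'e \<Rightarrow> ('a, 'e) tangent"
  where "coord_vector M c p e = (\<lambda>d. if d \<in> charts_at M p
    then frechet_derivative (snd d \<circ> param c) (at (snd c p)) e else 0)"


section \<open>Riemannian manifolds and their curvature\<close>

definition local_metric ::
    "('a, 'e::euclidean_space) riemannian \<Rightarrow> ('a, 'e) chart \<Rightarrow> 'e \<Rightarrow> 'e \<Rightarrow> 'e \<Rightarrow> real"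
  where "local_metric M c x u v =
    metric M (param c x) (coord_vector M c (param c x) u) (coord_vector M c (param c x) v)"

definition riemannian_manifold :: "('a, 'e::euclidean_space) riemannian \<Rightarrow> bool"
  where "riemannian_manifold M \<longleftrightarrow>
    smooth_manifold M \<and>
    (\<forall>p\<in>topspace (mtop M). \<forall>u\<in>tangent_space M p. \<forall>v\<in>tangent_space M p.
       metric M p u v = metric M p v u \<and>
       (\<forall>w\<in>tangent_space M p. \<forall>a b.
          metric M p (\<lambda>c. a *\<^sub>R u c + b *\<^sub>R v c) w = a * metric M p u w + b * metric M p v w) \<and>
       (u \<noteq> (\<lambda>c. 0) \<longrightarrow> metric M p u u > 0)) \<and>
    (\<forall>c\<in>atlas M. \<forall>u v. smooth_on (snd c ` fst c) (\<lambda>x. local_metric M c x u v))"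

text \<open>For a metric \<open>G\<close> on an open subset of a Euclidean space, \<open>christoffel G x u v\<close> is the
  covariant derivative at \<open>x\<close> of the constant vector field \<open>v\<close> in direction \<open>u\<close> with respect to
  the Levi-Civita connection, characterised by being torsion-free and metric.\<close>

definition christoffel ::
    "('e::euclidean_space \<Rightarrow> 'e \<Rightarrow> 'e \<Rightarrow> real) \<Rightarrow> 'e \<Rightarrow> 'e \<Rightarrow> 'e \<Rightarrow> 'e"
  where "christoffel G x = (THE \<Gamma>. bilinear \<Gamma> \<and> (\<forall>u v. \<Gamma> u v = \<Gamma> v u) \<and>
    (\<forall>u v w. frechet_derivative (\<lambda>y. G y v w) (at x) u = G x (\<Gamma> u v) w + G x v (\<Gamma> u w)))"

definition local_curvature ::
    "('e::euclidean_space \<Rightarrow> 'e \<Rightarrow> 'e \<Rightarrow> real) \<Rightarrow> 'e \<Rightarrow> 'e \<Rightarrow> 'e \<Rightarrow> 'e \<Rightarrow> 'e"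
  where "local_curvature G x u v w =
    frechet_derivative (\<lambda>y. christoffel G y v w) (at x) u
    - frechet_derivative (\<lambda>y. christoffel G y u w) (at x) v
    + christoffel G x u (christoffel G x v w) - christoffel G x v (christoffel G x u w)"

text \<open>The curvature tensor does not depend on the chart in which it is computed.\<close>

definition curvature ::
    "('a, 'e::euclidean_space) riemannian \<Rightarrow> 'a \<Rightarrow> ('a, 'e) tangent \<Rightarrow> ('a, 'e) tangent
      \<Rightarrow> ('a, 'e) tangent \<Rightarrow> ('a, 'e) tangent"
  where "curvature M p u v w = (let c = (SOME c. c \<in> charts_at M p) in
    coord_vector M c p (local_curvature (local_metric M c) (snd c p) (u c) (v c) (w c)))"

definition sectional_curvature ::
    "('a, 'e::euclidean_space) riemannian \<Rightarrow> 'a \<Rightarrow> ('a, 'e) tangent \<Rightarrow> ('a, 'e) tangent \<Rightarrow> real"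
  where "sectional_curvature M p u v =
    metric M p (curvature M p u v v) u
      / (metric M p u u * metric M p v v - (metric M p u v)\<^sup>2)"


section \<open>Kaehler manifolds\<close>

definition local_endo ::
    "('a, 'e::euclidean_space) riemannian \<Rightarrow> ('a \<Rightarrow> ('a, 'e) tangent \<Rightarrow> ('a, 'e) tangent)
      \<Rightarrow> ('a, 'e) chart \<Rightarrow> 'e \<Rightarrow> 'e \<Rightarrow> 'e"
  where "local_endo M J c x v = J (param c x) (coord_vector M c (param c x) v) c"

definition almost_complex_structure ::
    "('a, 'e::euclidean_space) riemannian \<Rightarrow> ('a \<Rightarrow> ('a, 'e) tangent \<Rightarrow> ('a, 'e) tangent) \<Rightarrow> bool"
  where "almost_complex_structure M J \<longleftrightarrow>
    (\<forall>p\<in>topspace (mtop M). \<forall>u\<in>tangent_space M p.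
       J p u \<in> tangent_space M p \<and>
       J p (J p u) = (\<lambda>c. - u c) \<and>
       (\<forall>v\<in>tangent_space M p. \<forall>a b.
          J p (\<lambda>c. a *\<^sub>R u c + b *\<^sub>R v c) = (\<lambda>c. a *\<^sub>R J p u c + b *\<^sub>R J p v c))) \<and>
    (\<forall>c\<in>atlas M. \<forall>v. smooth_on (snd c ` fst c) (\<lambda>x. local_endo M J c x v))"

definition orthogonal_endo ::
    "('a, 'e::euclidean_space) riemannian \<Rightarrow> ('a \<Rightarrow> ('a, 'e) tangent \<Rightarrow> ('a, 'e) tangent) \<Rightarrow> bool"
  where "orthogonal_endo M J \<longleftrightarrow>
    (\<forall>p\<in>topspace (mtop M). \<forall>u\<in>tangent_space M p. \<forall>v\<in>tangent_space M p.
       metric M p (J p u) (J p v) = metric M p u v)"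

text \<open>Coordinate expression of \<open>(\<nabla>\<^sub>u J) v = \<nabla>\<^sub>u (J v) - J (\<nabla>\<^sub>u v)\<close> for constant fields.\<close>

definition parallel_endo ::
    "('a, 'e::euclidean_space) riemannian \<Rightarrow> ('a \<Rightarrow> ('a, 'e) tangent \<Rightarrow> ('a, 'e) tangent) \<Rightarrow> bool"
  where "parallel_endo M J \<longleftrightarrow>
    (\<forall>c\<in>atlas M. \<forall>x\<in>snd c ` fst c. \<forall>u v.
       frechet_derivative (\<lambda>y. local_endo M J c y v) (at x) u
       + christoffel (local_metric M c) x u (local_endo M J c x v)
       - local_endo M J c x (christoffel (local_metric M c) x u v) = 0)"

definition kaehler_manifold ::
    "('a, 'e::euclidean_space) riemannian \<Rightarrow> ('a \<Rightarrow> ('a, 'e) tangent \<Rightarrow> ('a, 'e) tangent) \<Rightarrow> bool"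
  where "kaehler_manifold M J \<longleftrightarrow> riemannian_manifold M \<and>
    almost_complex_structure M J \<and> orthogonal_endo M J \<and> parallel_endo M J"


section \<open>Isometric immersions\<close>

definition smooth_map ::
    "('a, 'e::euclidean_space) riemannian \<Rightarrow> ('b, 'f::euclidean_space) riemannian
      \<Rightarrow> ('a \<Rightarrow> 'b) \<Rightarrow> bool"
  where "smooth_map M N f \<longleftrightarrow> continuous_map (mtop M) (mtop N) f \<and>
    (\<forall>c\<in>atlas M. \<forall>d\<in>atlas N. smooth_on (snd c ` (fst c \<inter> f -` fst d)) (snd d \<circ> f \<circ> param c))"

text \<open>The differential does not depend on the chart \<open>c\<close> of the domain.\<close>

definition differential ::
    "('a, 'e::euclidean_space) riemannian \<Rightarrow> ('b, 'f::euclidean_space) riemannian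
      \<Rightarrow> ('a \<Rightarrow> 'b) \<Rightarrow> 'a \<Rightarrow> ('a, 'e) tangent \<Rightarrow> ('b, 'f) tangent"
  where "differential M N f p v = (let c = (SOME c. c \<in> charts_at M p) in
    (\<lambda>d. if d \<in> charts_at N (f p)
      then frechet_derivative (snd d \<circ> f \<circ> param c) (at (snd c p)) (v c) else 0))"

definition isometric_immersion ::
    "('a, 'e::euclidean_space) riemannian \<Rightarrow> ('b, 'f::euclidean_space) riemannian
      \<Rightarrow> ('a \<Rightarrow> 'b) \<Rightarrow> bool"
  where "isometric_immersion M N f \<longleftrightarrow> smooth_map M N f \<and>
    (\<forall>p\<in>topspace (mtop M).
       inj_on (differential M N f p) (tangent_space M p) \<and>
       (\<forall>u\<in>tangent_space M p. \<forall>v\<in>tangent_space M p.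
          metric N (f p) (differential M N f p u) (differential M N f p v) = metric M p u v))"


section \<open>Hyperbolic space\<close>

text \<open>The hyperboloid model: the upper sheet of \<open>\<langle>p, p\<rangle> = -1\<close> in Lorentz space, with
  the induced metric. It is the graph of \<open>x \<mapsto> sqrt (1 + (norm x)\<^sup>2)\<close>, so that the projection
  \<open>snd\<close> is a global chart.\<close>

definition lorentz :: "real \<times> 'h::euclidean_space \<Rightarrow> real \<times> 'h \<Rightarrow> real"
  where "lorentz p q = snd p \<bullet> snd q - fst p * fst q"

definition hyperboloid :: "(real \<times> 'h::euclidean_space) set"
  where "hyperboloid = {p. lorentz p p = -1 \<and> fst p > 0}"

definition hyperbolic_space :: "(real \<times> 'h::euclidean_space, 'h) riemannian"
  where "hyperbolic_space =
    (let c = (hyperboloid, snd) in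
     \<lparr> mtop = top_of_set hyperboloid,
       atlas = {c},
       metric = (\<lambda>p u v. lorentz (frechet_derivative (param c) (at (snd p)) (u c))
                                (frechet_derivative (param c) (at (snd p)) (v c))) \<rparr>)"

end

theory Submission
  imports Defs
begin

text \<open>Let \<open>\<alpha>\<close> be the second fundamental form of the immersion, with values in the normal space of
  dimension \<open>n - 1\<close>, and let \<open>\<beta>(u, v) = \<alpha>(u, v) + \<alpha>(Ju, Jv)\<close>. The Gauss equation and polarisation turn
  positive holomorphic curvature into \<open>|\<beta>(u, u)|\<^sup>2 > 4 |u|\<^sup>4\<close>, while the Kaehler symmetries of the curvature
  give \<open>\<langle>\<beta>(v, v), \<beta>(u, u)\<rangle> = 4 |v|\<^sup>2 |u|\<^sup>2\<close> whenever \<open>u\<close> is orthogonal to \<open>v, Jv\<close> and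
  \<open>\<beta>(v, u) = \<beta>(v, Ju) = 0\<close>. Let \<open>v\<close> minimise \<open>|\<beta>(v, v)|\<close> among unit vectors. By the first order
  condition \<open>\<beta>(v, u)\<close> is orthogonal to \<open>\<beta>(v, v)\<close> for \<open>u\<close> orthogonal to \<open>v\<close>, so such a unit vector \<open>u\<close>
  exists by counting dimensions. Minimality along the arc from \<open>v\<close> to \<open>u\<close> then yields
  \<open>4 = \<langle>\<beta>(v, v), \<beta>(u, u)\<rangle> \<ge> |\<beta>(v, v)|\<^sup>2 > 4\<close>. The curvature identities at the point are obtained in a chart,
  where the immersion becomes a map \<open>\<Phi>\<close> into Lorentz space and the Christoffel symbols are the tangential
  part of the second derivative of \<open>\<Phi>\<close>.\<close>

section \<open>Differentiable functions and symmetry of second derivatives\<close>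

lemma Ck_on_cong:
  assumes "open S" "\<And>x. x \<in> S \<Longrightarrow> f x = g x" "Ck_on k S f"
  shows "Ck_on k S g"
  using assms(2,3)
proof (induction k arbitrary: f g)
  case 0
  then show ?case by (simp cong: continuous_on_cong)
next
  case (Suc k)
  have der: "(g has_derivative frechet_derivative f (at x)) (at x)" if "x \<in> S" for x
    using Suc.prems that assms(1)
    by (auto intro!: has_derivative_transform_within_open[of f _ x UNIV S g] simp: frechet_derivative_works)
  then have eq: "frechet_derivative f (at x) = frechet_derivative g (at x)" if "x \<in> S" for x
    using that frechet_derivative_at by blast
  have "Ck_on k S (\<lambda>x. frechet_derivative g (at x) v)" for v
    by (rule Suc.IH[of "\<lambda>x. frechet_derivative f (at x) v"]) (use Suc.prems(2) eq in simp_all)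
  with der show ?case by (auto simp: differentiable_def)
qed

lemma Ck_on_Suc_imp: "Ck_on (Suc k) S f \<Longrightarrow> Ck_on k S f"
proof (induction k arbitrary: f)
  case 0
  then show ?case
    by (auto intro!: continuous_at_imp_continuous_on differentiable_imp_continuous_within)
next
  case (Suc k)
  then show ?case by (metis Ck_on.simps(2))
qed

lemma Ck_on_const: "Ck_on k S (\<lambda>x. c)"
  by (induction k arbitrary: c) auto

lemma Ck_on_add:
  assumes "open S" "Ck_on k S f" "Ck_on k S g"
  shows "Ck_on k S (\<lambda>x. f x + g x)"
  using assms(2,3)
proof (induction k arbitrary: f g)
  case 0
  then show ?case by (auto intro: continuous_intros)
next
  case (Suc k)
  have der: "((\<lambda>x. f x + g x) has_derivative
      (\<lambda>v. frechet_derivative f (at x) v + frechet_derivative g (at x) v)) (at x)" if "x \<in> S" for x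
    using Suc.prems that by (auto intro!: has_derivative_add simp: frechet_derivative_works)
  have "Ck_on k S (\<lambda>x. frechet_derivative (\<lambda>x. f x + g x) (at x) v)" for v
  proof (rule Ck_on_cong[OF assms(1)])
    show "Ck_on k S (\<lambda>x. frechet_derivative f (at x) v + frechet_derivative g (at x) v)"
      using Suc.prems by (intro Suc.IH) auto
  qed (simp flip: frechet_derivative_at[OF der])
  with der show ?case by (auto simp: differentiable_def)
qed

text \<open>The product rule turns the derivative into a sum of two products of the same kind, which
  is why the induction leaves \<open>f\<close> and \<open>g\<close> arbitrary. Each product pairs a
  derivative with an undifferentiated factor, whose class \<open>Ck_on_Suc_imp\<close> lowers to
  \<open>k\<close>.\<close>

lemma Ck_on_bilinear:
  assumes "bounded_bilinear B" "open S" "Ck_on k S f" "Ck_on k S g"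
  shows "Ck_on k S (\<lambda>x. B (f x) (g x))"
  using assms(3,4)
proof (induction k arbitrary: f g)
  case 0
  then show ?case using bounded_bilinear.continuous_on[OF assms(1)] by auto
next
  case (Suc k)
  have der: "((\<lambda>x. B (f x) (g x)) has_derivative
      (\<lambda>v. B (f x) (frechet_derivative g (at x) v) + B (frechet_derivative f (at x) v) (g x))) (at x)"
    if "x \<in> S" for x
    using Suc.prems that
    by (auto intro!: bounded_bilinear.FDERIV[OF assms(1)] simp: frechet_derivative_works)
  have "Ck_on k S (\<lambda>x. frechet_derivative (\<lambda>x. B (f x) (g x)) (at x) v)" for v
  proof (rule Ck_on_cong[OF assms(2)])
    show "Ck_on k S (\<lambda>x. B (f x) (frechet_derivative g (at x) v) + B (frechet_derivative f (at x) v) (g x))"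
      using Suc.prems Suc.prems[THEN Ck_on_Suc_imp]
      by (intro Ck_on_add[OF assms(2)] Suc.IH) auto
  qed (simp flip: frechet_derivative_at[OF der])
  with der show ?case by (auto simp: differentiable_def)
qed

text \<open>A linear map is the bilinear map \<open>a *\<^sub>R h b\<close> with its first argument
  frozen at \<open>1\<close>.\<close>

lemma Ck_on_bounded_linear:
  assumes "bounded_linear h" "open S" "Ck_on k S f"
  shows "Ck_on k S (\<lambda>x. h (f x))"
proof -
  have "bounded_bilinear (\<lambda>(a::real) b. a *\<^sub>R h b)"
    using bounded_bilinear.comp[OF bounded_bilinear_scaleR bounded_linear_ident assms(1)] by simp
  from Ck_on_bilinear[OF this assms(2) Ck_on_const[of k S 1] assms(3)] show ?thesis by simp
qed

text \<open>The derivative is a polynomial in the derivative of \<open>f\<close> and in the inverse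
  of \<open>f\<close> itself, so the induction keeps \<open>f\<close> fixed and feeds the claim for
  \<open>k\<close> back into the derivative. The square root below is treated in the same
  way.\<close>

lemma Ck_on_inverse:
  fixes f :: "'e::euclidean_space \<Rightarrow> real"
  assumes "open S" "\<And>x. x \<in> S \<Longrightarrow> f x \<noteq> 0" "Ck_on k S f"
  shows "Ck_on k S (\<lambda>x. inverse (f x))"
  using assms(3)
proof (induction k)
  case 0
  then show ?case using assms(2) by (auto intro: continuous_intros)
next
  case (Suc k)
  have der: "((\<lambda>x. inverse (f x)) has_derivative
      (\<lambda>v. - (inverse (f x) * frechet_derivative f (at x) v * inverse (f x)))) (at x)"
    if "x \<in> S" for x
    using Suc.prems that assms(2)
    by (auto intro!: has_derivative_inverse simp: frechet_derivative_works)
  have "Ck_on k S (\<lambda>x. frechet_derivative (\<lambda>x. inverse (f x)) (at x) v)" for v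
  proof (rule Ck_on_cong[OF assms(1)])
    show "Ck_on k S (\<lambda>x. - (inverse (f x) * frechet_derivative f (at x) v * inverse (f x)))"
      using Suc.prems Suc.IH[OF Ck_on_Suc_imp[OF Suc.prems]]
      by (intro Ck_on_bounded_linear[OF bounded_linear_minus[OF bounded_linear_ident]]
          Ck_on_bilinear[OF bounded_bilinear_mult] assms(1)) auto
  qed (simp flip: frechet_derivative_at[OF der])
  with der show ?case by (auto simp: differentiable_def)
qed

lemma Ck_on_sqrt:
  fixes f :: "'e::euclidean_space \<Rightarrow> real"
  assumes "open S" "\<And>x. x \<in> S \<Longrightarrow> f x > 0" "Ck_on k S f"
  shows "Ck_on k S (\<lambda>x. sqrt (f x))"
  using assms(3)
proof (induction k)
  case 0
  then show ?case by (auto intro: continuous_intros)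
next
  case (Suc k)
  have der: "((\<lambda>x. sqrt (f x)) has_derivative
      (\<lambda>v. frechet_derivative f (at x) v * (inverse (sqrt (f x)) * (1 / 2)))) (at x)"
    if "x \<in> S" for x
    using Suc.prems that assms(2)[OF that]
    by (auto intro!: derivative_eq_intros simp: frechet_derivative_works field_simps)
  have "Ck_on k S (\<lambda>x. frechet_derivative (\<lambda>x. sqrt (f x)) (at x) v)" for v
  proof (rule Ck_on_cong[OF assms(1)])
    show "Ck_on k S (\<lambda>x. frechet_derivative f (at x) v * (inverse (sqrt (f x)) * (1 / 2)))"
      using Suc.prems Suc.IH[OF Ck_on_Suc_imp[OF Suc.prems]] assms(2)
      by (intro Ck_on_bilinear[OF bounded_bilinear_mult] Ck_on_inverse Ck_on_const assms(1))
         (auto simp: less_imp_neq[symmetric])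
  qed (simp flip: frechet_derivative_at[OF der])
  with der show ?case by (auto simp: differentiable_def)
qed

text \<open>Differencing in direction \<open>v\<close> and then applying the mean value theorem in
  direction \<open>u\<close> leaves an increment of \<open>D y u\<close> over the step
  \<open>t *\<^sub>R v\<close>, which \<open>E\<close> describes to first order.\<close>

lemma second_difference_estimate:
  fixes f :: "'e::real_normed_vector \<Rightarrow> real"
  assumes S: "open S" "x \<in> S"
    and D: "\<And>y. y \<in> S \<Longrightarrow> (f has_derivative D y) (at y)"
    and E: "((\<lambda>y. D y u) has_derivative E) (at x)"
    and "e > 0"
  shows "\<exists>d>0. \<forall>t. 0 < t \<and> t < d \<longrightarrow>
    \<bar>f (x + t *\<^sub>R u + t *\<^sub>R v) - f (x + t *\<^sub>R u) - f (x + t *\<^sub>R v) + f x - t\<^sup>2 * E v\<bar> \<le> e * t\<^sup>2"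
proof -
  \<comment> \<open>All displacements from \<open>x\<close> that occur have norm at most
    \<open>t * c\<close>; the summand \<open>1\<close> keeps \<open>c\<close> positive when
    \<open>u\<close> and \<open>v\<close> vanish.\<close>
  define c where "c = norm u + norm v + 1"
  have c: "c > 0" by (simp add: c_def add_nonneg_pos)
  obtain r where r: "r > 0" "ball x r \<subseteq> S" using S openE by blast
  have linE: "linear E" using E has_derivative_linear by blast
  \<comment> \<open>The tolerance \<open>e\<close> is shared by two error terms, each at a
    displacement of norm at most \<open>t * c\<close>.\<close>
  have "e / (2 * c) > 0" using c \<open>e > 0\<close> by simp
  with E obtain d where d: "d > 0"
    "\<And>y. norm (y - x) < d \<Longrightarrow> norm (D y u - D x u - E (y - x)) \<le> e / (2 * c) * norm (y - x)"
    unfolding has_derivative_at_alt by blast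
  have "\<bar>f (x + t *\<^sub>R u + t *\<^sub>R v) - f (x + t *\<^sub>R u) - f (x + t *\<^sub>R v) + f x - t\<^sup>2 * E v\<bar> \<le> e * t\<^sup>2"
    if t: "0 < t" "t < min d r / c" for t
  proof -
    have tc: "t * c < d" "t * c < r" using t c by (auto simp: field_simps)
    have near: "norm (s *\<^sub>R (t *\<^sub>R u) + q *\<^sub>R (t *\<^sub>R v)) \<le> t * c" if "s \<in> {0..1}" "q \<in> {0..1}" for s q :: real
    proof -
      have "norm (s *\<^sub>R (t *\<^sub>R u) + q *\<^sub>R (t *\<^sub>R v)) \<le> s * (t * norm u) + q * (t * norm v)"
        using norm_triangle_ineq[of "s *\<^sub>R (t *\<^sub>R u)" "q *\<^sub>R (t *\<^sub>R v)"] t that by simp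
      also have "\<dots> \<le> 1 * (t * norm u) + 1 * (t * norm v)"
        using that t by (intro add_mono mult_right_mono) auto
      also have "\<dots> \<le> t * c" using t by (simp add: c_def algebra_simps)
      finally show ?thesis .
    qed
    have inS: "x + (s *\<^sub>R (t *\<^sub>R u) + q *\<^sub>R (t *\<^sub>R v)) \<in> S" if "s \<in> {0..1}" "q \<in> {0..1}" for s q :: real
    proof -
      have "x + (s *\<^sub>R (t *\<^sub>R u) + q *\<^sub>R (t *\<^sub>R v)) \<in> ball x r"
        using near[OF that] tc by (simp only: mem_ball dist_norm add_diff_cancel_left' norm_minus_commute[of x])
      then show ?thesis using r by blast
    qed
    define g where "g s = f (x + s *\<^sub>R (t *\<^sub>R u) + t *\<^sub>R v) - f (x + s *\<^sub>R (t *\<^sub>R u))" for s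
    have der: "(g has_derivative (\<lambda>h. D (x + s *\<^sub>R (t *\<^sub>R u) + t *\<^sub>R v) (h *\<^sub>R (t *\<^sub>R u))
          - D (x + s *\<^sub>R (t *\<^sub>R u)) (h *\<^sub>R (t *\<^sub>R u)))) (at s within {0..1})" if "s \<in> {0..1}" for s
    proof -
      have "((\<lambda>s. x + s *\<^sub>R (t *\<^sub>R u) + t *\<^sub>R v) has_derivative (\<lambda>h. h *\<^sub>R (t *\<^sub>R u))) (at s within {0..1})"
           "((\<lambda>s. x + s *\<^sub>R (t *\<^sub>R u)) has_derivative (\<lambda>h. h *\<^sub>R (t *\<^sub>R u))) (at s within {0..1})"
        by (auto intro!: derivative_eq_intros)
      moreover have "x + s *\<^sub>R (t *\<^sub>R u) + t *\<^sub>R v \<in> S" "x + s *\<^sub>R (t *\<^sub>R u) \<in> S"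
        using inS[of s 1] inS[of s 0] that by (auto simp: add.assoc)
      ultimately show ?thesis unfolding g_def
        using has_derivative_compose[OF _ D, where f = "\<lambda>s. x + s *\<^sub>R (t *\<^sub>R u) + t *\<^sub>R v"]
          has_derivative_compose[OF _ D, where f = "\<lambda>s. x + s *\<^sub>R (t *\<^sub>R u)"]
        by (intro has_derivative_diff) simp_all
    qed
    obtain s where s: "s \<in> {0..1}" and gs: "g 1 - g 0 = D (x + s *\<^sub>R (t *\<^sub>R u) + t *\<^sub>R v) ((1 - 0) *\<^sub>R (t *\<^sub>R u))
          - D (x + s *\<^sub>R (t *\<^sub>R u)) ((1 - 0) *\<^sub>R (t *\<^sub>R u))"
      using mvt_very_simple[of 0 1 g, OF _ der] by auto
    define p where "p = s *\<^sub>R (t *\<^sub>R u) + 1 *\<^sub>R (t *\<^sub>R v)"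
    define q where "q = s *\<^sub>R (t *\<^sub>R u) + 0 *\<^sub>R (t *\<^sub>R v)"
    have pS: "x + p \<in> S" "x + q \<in> S" "norm p \<le> t * c" "norm q \<le> t * c"
      using inS[of s 1] inS[of s 0] near[of s 1] near[of s 0] s by (auto simp: p_def q_def)
    have lin: "D y (t *\<^sub>R u) = t * D y u" if "y \<in> S" for y
      using linear_cmul[OF has_derivative_linear[OF D[OF that]]] by simp
    have g10: "g 1 - g 0 = t * (D (x + p) u - D (x + q) u)"
      using pS unfolding gs by (simp add: p_def q_def lin right_diff_distrib flip: add.assoc)
    have Epq: "E p - E q = t * E v"
      by (simp add: p_def q_def linear_add[OF linE] linear_cmul[OF linE])
    have est: "\<bar>D (x + p) u - D x u - E p\<bar> \<le> e / 2 * t" "\<bar>D (x + q) u - D x u - E q\<bar> \<le> e / 2 * t"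
    proof -
      have "\<bar>D (x + z) u - D x u - E z\<bar> \<le> e / 2 * t" if z: "norm z \<le> t * c" for z
      proof -
        have "\<bar>D (x + z) u - D x u - E z\<bar> \<le> e / (2 * c) * norm z"
          using d(2)[of "x + z"] z tc by simp
        also have "\<dots> \<le> e / (2 * c) * (t * c)"
          using z \<open>e > 0\<close> c by (intro mult_left_mono) auto
        finally show ?thesis using c by simp
      qed
      with pS show "\<bar>D (x + p) u - D x u - E p\<bar> \<le> e / 2 * t" "\<bar>D (x + q) u - D x u - E q\<bar> \<le> e / 2 * t"
        by simp_all
    qed
    have "\<bar>g 1 - g 0 - t\<^sup>2 * E v\<bar> = t * \<bar>(D (x + p) u - D x u - E p) - (D (x + q) u - D x u - E q)\<bar>"
    proof -
      have "g 1 - g 0 - t\<^sup>2 * E v = t * ((D (x + p) u - D x u - E p) - (D (x + q) u - D x u - E q))"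
        using Epq g10 by (simp add: power2_eq_square algebra_simps)
      then show ?thesis using t by (simp add: abs_mult)
    qed
    also have "\<dots> \<le> t * (e * t)"
      using est t by (intro mult_left_mono) linarith+
    finally show ?thesis by (simp add: g_def power2_eq_square algebra_simps)
  qed
  then show ?thesis using d r c by (intro exI[of _ "min d r / c"]) auto
qed

text \<open>The second difference is symmetric in \<open>u\<close> and \<open>v\<close>, and divided
  by the square of \<open>t\<close> it tends to both \<open>E v\<close> and
  \<open>E' u\<close>.\<close>

lemma second_derivative_symmetric_real:
  fixes f :: "'e::real_normed_vector \<Rightarrow> real"
  assumes "open S" "x \<in> S" "\<And>y. y \<in> S \<Longrightarrow> (f has_derivative D y) (at y)"
    and "((\<lambda>y. D y u) has_derivative E) (at x)" "((\<lambda>y. D y v) has_derivative E') (at x)"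
  shows "E v = E' u"
proof (rule ccontr)
  assume "E v \<noteq> E' u"
  \<comment> \<open>With a quarter of the gap as tolerance, the two estimates allow a deviation of 2
    e t^2, against a gap of 4 e t^2.\<close>
  define e where "e = \<bar>E v - E' u\<bar> / 4"
  have e: "e > 0" using \<open>E v \<noteq> E' u\<close> by (simp add: e_def)
  obtain d where d: "d > 0" "\<And>t. 0 < t \<and> t < d \<Longrightarrow>
    \<bar>f (x + t *\<^sub>R u + t *\<^sub>R v) - f (x + t *\<^sub>R u) - f (x + t *\<^sub>R v) + f x - t\<^sup>2 * E v\<bar> \<le> e * t\<^sup>2"
    using second_difference_estimate[OF assms(1-4) e] by blast
  obtain d' where d': "d' > 0" "\<And>t. 0 < t \<and> t < d' \<Longrightarrow>
    \<bar>f (x + t *\<^sub>R v + t *\<^sub>R u) - f (x + t *\<^sub>R v) - f (x + t *\<^sub>R u) + f x - t\<^sup>2 * E' u\<bar> \<le> e * t\<^sup>2"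
    using second_difference_estimate[OF assms(1-3,5) e] by blast
  define t where "t = min d d' / 2"
  have t: "0 < t" "t < d" "t < d'" using d d' by (auto simp: t_def min_def)
  have "\<bar>t\<^sup>2 * E v - t\<^sup>2 * E' u\<bar> \<le> 2 * e * t\<^sup>2"
    using d(2)[of t] d'(2)[of t] t by (simp add: add.commute add.left_commute)
  moreover have "\<bar>t\<^sup>2 * E v - t\<^sup>2 * E' u\<bar> = 4 * e * t\<^sup>2"
    by (simp add: e_def abs_mult flip: right_diff_distrib)
  ultimately show False using e t by simp
qed

text \<open>Reduction to components. The derivatives are arguments, so that explicit formulas for
  them, as obtained later from the parallelism of \<open>J\<close>, can be compared
  directly.\<close>

lemma second_derivative_symmetric:
  fixes f :: "'e::real_normed_vector \<Rightarrow> 'f::euclidean_space"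
  assumes S: "open S" "x \<in> S" and D: "\<And>y. y \<in> S \<Longrightarrow> (f has_derivative D y) (at y)"
    and E: "((\<lambda>y. D y u) has_derivative E) (at x)" "((\<lambda>y. D y v) has_derivative E') (at x)"
  shows "E v = E' u"
proof (rule euclidean_eqI)
  fix b :: 'f assume "b \<in> Basis"
  show "E v \<bullet> b = E' u \<bullet> b"
  proof (rule second_derivative_symmetric_real[of S x "\<lambda>y. f y \<bullet> b" "\<lambda>y h. D y h \<bullet> b" u "\<lambda>h. E h \<bullet> b" v "\<lambda>h. E' h \<bullet> b"])
    show "((\<lambda>y. f y \<bullet> b) has_derivative (\<lambda>h. D y h \<bullet> b)) (at y)" if "y \<in> S" for y
      by (rule has_derivative_inner_left[OF D[OF that]])
  qed (rule S has_derivative_inner_left[OF E(1)] has_derivative_inner_left[OF E(2)])+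
qed

lemma Ck_on_second_derivative_symmetric:
  fixes f :: "'e::euclidean_space \<Rightarrow> 'f::euclidean_space"
  assumes "open S" "x \<in> S" "Ck_on (Suc (Suc k)) S f"
  shows "frechet_derivative (\<lambda>y. frechet_derivative f (at y) u) (at x) v
       = frechet_derivative (\<lambda>y. frechet_derivative f (at y) v) (at x) u"
  using assms
  by (intro second_derivative_symmetric[OF assms(1,2), of f "\<lambda>y. frechet_derivative f (at y)" u _ v])
     (auto simp flip: frechet_derivative_works)

section \<open>Algebra of the second fundamental form\<close>

text \<open>The polynomial vanishes at 0, which is therefore a minimum, and \<open>p\<close> is its
  derivative there.\<close>

lemma linear_coeff_eq_zero:
  fixes p q r s :: real
  assumes "\<And>t. p * t + q * t^2 + r * t^3 + s * t^4 \<ge> 0"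
  shows "p = 0"
proof -
  have "((\<lambda>t. p * t + q * t^2 + r * t^3 + s * t^4) has_real_derivative p) (at 0)"
    by (auto intro!: derivative_eq_intros)
  from DERIV_local_min[OF this, of 1] assms show ?thesis by simp
qed

lemma quadratic_coeff_nonneg:
  fixes q s :: real
  assumes "\<And>t. q * t^2 + s * t^4 \<ge> 0"
  shows "q \<ge> 0"
proof (rule ccontr)
  assume "\<not> q \<ge> 0"
  \<comment> \<open>\<open>x\<close> plays the role of t^2. It is so small that the quartic term is
    at most half the size of the quadratic one.\<close>
  define x where "x = - q / (2 * (\<bar>s\<bar> + 1))"
  have x: "x > 0" using \<open>\<not> q \<ge> 0\<close> by (simp add: x_def field_simps)
  have "\<bar>s\<bar> * x \<le> (\<bar>s\<bar> + 1) * x" using x by simp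
  also have "\<dots> = - q / 2" by (simp add: x_def field_simps)
  finally have "s * x \<le> - q / 2" using x by (smt (verit) mult_right_mono abs_ge_self)
  moreover have "x * (q + s * x) \<ge> 0"
    using assms[of "sqrt x"] x by (simp add: algebra_simps power4_eq_xxxx power2_eq_square)
  then have "q + s * x \<ge> 0" using x by (simp add: zero_le_mult_iff)
  ultimately show False using \<open>\<not> q \<ge> 0\<close> by simp
qed

lemma linear_kernel_of_range_dim_less:
  fixes T :: "'e::euclidean_space \<Rightarrow> 'w::euclidean_space"
  assumes "linear T" "\<And>x. T x \<in> S" "dim S < DIM('e)"
  obtains x where "x \<noteq> 0" "T x = 0"
proof -
  have "\<not> inj T"
  proof
    assume "inj T"
    then have "dim (range T) = DIM('e)"
      using dim_image_eq[of T UNIV] assms(1) by simp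
    moreover have "dim (range T) \<le> dim S" using assms(2) by (intro dim_subset) auto
    ultimately show False using assms(3) by simp
  qed
  then show ?thesis using that linear_injective_0[OF assms(1)] by blast
qed

text \<open>The algebraic data at one point: \<open>\<alpha>\<close> is the second fundamental form of a submanifold of
  hyperbolic space, with values in the normal space \<open>N\<close>.\<close>

locale kaehler_second_fundamental_form =
  G: bounded_bilinear G + L: bounded_bilinear L + \<alpha>: bounded_bilinear \<alpha> + J: bounded_linear J
  for G :: "'e::euclidean_space \<Rightarrow> 'e \<Rightarrow> real"
    and L :: "'w::euclidean_space \<Rightarrow> 'w \<Rightarrow> real"
    and \<alpha> :: "'e \<Rightarrow> 'e \<Rightarrow> 'w"
    and J :: "'e \<Rightarrow> 'e" +
  fixes N :: "'w set" and R :: "'e \<Rightarrow> 'e \<Rightarrow> 'e \<Rightarrow> 'e \<Rightarrow> real"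
  assumes G_sym: "G u v = G v u" and G_pos: "u \<noteq> 0 \<Longrightarrow> G u u > 0"
    and L_sym: "L a b = L b a" and L_pos: "a \<in> N \<Longrightarrow> a \<noteq> 0 \<Longrightarrow> L a a > 0"
    and subspace_N: "subspace N" and \<alpha>_N: "\<alpha> u v \<in> N" and \<alpha>_sym: "\<alpha> u v = \<alpha> v u"
    and J_J: "J (J u) = - u" and G_J: "G (J u) (J v) = G u v"
    and gauss: "R u v w z = L (\<alpha> v w) (\<alpha> u z) - L (\<alpha> u w) (\<alpha> v z) - G v w * G u z + G u w * G v z"
    and R_J: "R u v (J w) (J z) = R u v w z"
    and R_pos: "u \<noteq> 0 \<Longrightarrow> R u (J u) (J u) u > 0"
begin

text \<open>Twice the (1,1)-part of \<alpha> with respect to \<open>J\<close>.\<close>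

definition \<beta> where "\<beta> u v = \<alpha> u v + \<alpha> (J u) (J v)"

lemma \<beta>_N: "\<beta> u v \<in> N"
  unfolding \<beta>_def by (intro subspace_add subspace_N \<alpha>_N)

lemma \<beta>_sym: "\<beta> u v = \<beta> v u"
  by (simp add: \<beta>_def \<alpha>_sym)

lemma \<beta>_J: "\<beta> u (J v) = \<alpha> u (J v) - \<alpha> (J u) v"
  by (simp add: \<beta>_def J_J \<alpha>.minus_right)

lemma bounded_bilinear_\<beta>: "bounded_bilinear \<beta>"
  unfolding bilinear_conv_bounded_bilinear[symmetric] bilinear_def
  by (auto intro!: linearI simp: \<beta>_def \<alpha>.add_left \<alpha>.add_right \<alpha>.scaleR_left \<alpha>.scaleR_right
      J.add J.scaleR scaleR_add_right)

sublocale \<beta>: bounded_bilinear \<beta> by (rule bounded_bilinear_\<beta>)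

lemma L_nonneg: "a \<in> N \<Longrightarrow> L a a \<ge> 0"
  using L_pos[of a] by (cases "a = 0") (auto simp: L.zero_left)

lemma G_J_left: "G (J u) v = - G u (J v)"
  using G_J[of u "J v"] by (simp add: J_J G.minus_right)

lemma G_J_self: "G u (J u) = 0"
  using G_J_left[of u u] G_sym[of u "J u"] by simp

text \<open>The Gauss equation for the plane of \<open>u\<close> and \<open>J u\<close> gives <a, b>
  > |u|^4 for the two summands a, b of \<open>\<beta> u u\<close>, and |a + b|^2 = |a - b|^2 + 4 <a,
  b>.\<close>

lemma L_\<beta>_\<beta>_gt:
  assumes "u \<noteq> 0"
  shows "L (\<beta> u u) (\<beta> u u) > 4 * (G u u)\<^sup>2"
proof -
  define a b where "a = \<alpha> u u" and "b = \<alpha> (J u) (J u)"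
  have "L (a - b) (a - b) \<ge> 0" "L (\<alpha> u (J u)) (\<alpha> u (J u)) \<ge> 0"
    by (auto simp: a_def b_def intro!: L_nonneg subspace_diff subspace_N \<alpha>_N)
  moreover have "L b a - L (\<alpha> u (J u)) (\<alpha> u (J u)) - G u u * G u u > 0"
    using R_pos[OF assms] unfolding gauss a_def b_def
    by (simp add: G_J G_J_self \<alpha>_sym[of "J u" u])
  ultimately show ?thesis
    by (simp add: \<beta>_def L.add_left L.add_right L.diff_left L.diff_right L_sym[of b a] power2_eq_square
        flip: a_def b_def)
qed

text \<open>For x in {u, Ju} and y in {v, Jv}, the Gauss equation on both sides of R(x, y, y, x) =
  R(x, y, Jy, Jx) gives <\<alpha>(y, y), \<alpha>(x, x)> = |x|^2 |y|^2 + |\<alpha>(x, y)|^2 -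
  |\<alpha>(Jx, y)|^2 + <\<alpha>(x, Jx), \<alpha>(y, Jy)>. The last three terms change sign when x
  is replaced by Jx or y by Jy, so they cancel in the sum of the four equations.\<close>

lemma L_\<beta>_\<beta>_eq:
  assumes "\<beta> v u = 0" "\<beta> v (J u) = 0" "G v u = 0" "G v (J u) = 0"
  shows "L (\<beta> v v) (\<beta> u u) = 4 * G v v * G u u"
proof -
  have \<alpha>1: "\<alpha> (J v) (J u) = - \<alpha> v u" "\<alpha> (J v) u = \<alpha> v (J u)"
    using assms(1,2) by (auto simp: \<beta>_J) (simp add: \<beta>_def eq_neg_iff_add_eq_0 add.commute)
  have G1: "G u v = 0" "G (J v) u = 0" "G u (J v) = 0" "G (J u) v = 0"
    using assms(3,4) by (auto simp: G_sym[of u] G_sym[of _ v] G_J_left)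
  note rules = gauss \<alpha>1 G1 assms(3,4) J_J G_J G_J_self \<alpha>.minus_left \<alpha>.minus_right L.minus_left L.minus_right
     G.minus_left G.minus_right \<alpha>_sym[of u v] \<alpha>_sym[of "J u" v] \<alpha>_sym[of "J u" "J v"]
     \<alpha>_sym[of u "J v"] \<alpha>_sym[of "J u" u] \<alpha>_sym[of "J v" v] G_sym[of "J u" u] G_sym[of "J v" v]
  show ?thesis
    using R_J[of "J v" "J u" u v] R_J[of u v v u] R_J[of "J v" u "- J u" v] R_J[of v "J u" u "- J v"]
      R_J[of "J u" v v "- J u"] R_J[of v u v u]
    by (simp add: rules J.neg \<beta>_def L.add_left L.add_right L_sym algebra_simps)
qed

text \<open>The quotient \<open>f\<close> is invariant under scaling, so its minimum over the
  compact Euclidean unit sphere is a minimum over all directions; the minimiser is then rescaled to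
  unit length for \<open>G\<close>.\<close>

lemma minimal_direction:
  obtains v where "G v v = 1" "\<And>u. L (\<beta> u u) (\<beta> u u) \<ge> L (\<beta> v v) (\<beta> v v) * (G u u)\<^sup>2"
proof -
  define f where "f u = L (\<beta> u u) (\<beta> u u) / (G u u)\<^sup>2" for u
  have "continuous_on (sphere 0 1) f"
    unfolding f_def
    by (intro continuous_intros L.continuous_on \<beta>.continuous_on G.continuous_on)
       (metis G_pos less_irrefl norm_zero power_not_zero sphere_eq_empty mem_sphere_0 zero_neq_one)
  moreover have "sphere (0::'e) 1 \<noteq> {}" by simp
  ultimately obtain w where w: "norm w = 1" "\<And>u. norm u = 1 \<Longrightarrow> f w \<le> f u"
    using continuous_attains_inf[of "sphere (0::'e) 1" f] by auto
  have f_scale: "f (c *\<^sub>R u) = f u" if "c \<noteq> 0" for c u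
    using that
    by (simp add: f_def L.scaleR_left L.scaleR_right \<beta>.scaleR_left \<beta>.scaleR_right
        G.scaleR_left G.scaleR_right power2_eq_square)
  have min: "f w \<le> f u" if "u \<noteq> 0" for u
    using w(2)[of "inverse (norm u) *\<^sub>R u"] f_scale[of "inverse (norm u)" u] that by simp
  have Gw: "G w w > 0" using w(1) G_pos[of w] by fastforce
  define v where "v = inverse (sqrt (G w w)) *\<^sub>R w"
  have Gv: "G v v = 1"
    using Gw by (simp add: v_def G.scaleR_left G.scaleR_right field_simps)
  have fv: "f w = L (\<beta> v v) (\<beta> v v)"
    using f_scale[of "inverse (sqrt (G w w))" w] Gw Gv by (simp add: f_def flip: v_def)
  have "L (\<beta> u u) (\<beta> u u) \<ge> L (\<beta> v v) (\<beta> v v) * (G u u)\<^sup>2" for u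
  proof (cases "u = 0")
    case False
    from min[OF this, unfolded fv] G_pos[OF this] show ?thesis by (simp add: f_def field_simps)
  qed (simp add: G.zero_left L.zero_left \<beta>.zero_left)
  with Gv that show ?thesis by blast
qed

theorem codimension_bound: "DIM('e) \<le> 2 * dim N"
proof (rule ccontr)
  assume dim: "\<not> DIM('e) \<le> 2 * dim N"
  obtain v where Gv: "G v v = 1" and min: "\<And>u. L (\<beta> u u) (\<beta> u u) \<ge> L (\<beta> v v) (\<beta> v v) * (G u u)\<^sup>2"
    using minimal_direction by blast
  define a where "a = \<beta> v v"
  have v: "v \<noteq> 0" using Gv by (auto simp: G.zero_left)
  have a: "L a a > 4" using L_\<beta>_\<beta>_gt[OF v] Gv by (simp add: a_def)
  have aN: "a \<in> N" by (simp add: a_def \<beta>_N)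
  \<comment> \<open>Minimality at \<open>v + t *\<^sub>R u\<close>, expanded in powers of
    \<open>t\<close>. The constant terms cancel because \<open>G v v = 1\<close>.\<close>
  have quartic: "4 * L a (\<beta> v u) * t + (2 * L a (\<beta> u u) + 4 * L (\<beta> v u) (\<beta> v u) - 2 * L a a * G u u) * t^2
      + 4 * L (\<beta> v u) (\<beta> u u) * t^3 + (L (\<beta> u u) (\<beta> u u) - L a a * (G u u)\<^sup>2) * t^4 \<ge> 0"
    if "G v u = 0" for u t
  proof -
    have \<beta>t: "\<beta> (v + t *\<^sub>R u) (v + t *\<^sub>R u) = a + (2 * t) *\<^sub>R \<beta> v u + t\<^sup>2 *\<^sub>R \<beta> u u"
      by (simp add: a_def \<beta>.add_left \<beta>.add_right \<beta>.scaleR_left \<beta>.scaleR_right \<beta>_sym[of u v] power2_eq_square scaleR_2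
          scaleR_add_right flip: scaleR_scaleR)
    have Gt: "G (v + t *\<^sub>R u) (v + t *\<^sub>R u) = 1 + t\<^sup>2 * G u u"
      using that by (simp add: Gv G.add_left G.add_right G.scaleR_left G.scaleR_right G_sym[of u v] power2_eq_square)
    show ?thesis
      using min[of "v + t *\<^sub>R u"] unfolding \<beta>t Gt a_def[symmetric]
      by (simp add: L.add_left L.add_right L.scaleR_left L.scaleR_right L_sym[of "\<beta> v u" a] L_sym[of "\<beta> u u" a]
          L_sym[of "\<beta> u u" "\<beta> v u"] power2_eq_square power3_eq_cube power4_eq_xxxx algebra_simps)
  qed
  have first_order: "L a (\<beta> v u) = 0" if "G v u = 0" for u
    using linear_coeff_eq_zero[OF quartic[OF that]] by simp
  \<comment> \<open>The complement of \<open>a\<close> in \<open>N\<close>. It is proper because <a,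
    a> > 4, and this saved dimension is what the count below rests on.\<close>
  define N' where "N' = {b \<in> N. L a b = 0}"
  have subN': "subspace N'"
    using subspace_N by (auto simp: N'_def subspace_def L.zero_right L.add_right L.scaleR_right)
  have "N' \<subset> N" using aN a by (force simp: N'_def)
  then have dimN': "dim N' < dim N"
    by (metis dim_psubset span_eq_iff subN' subspace_N)
  \<comment> \<open>Subtracting multiples of \<open>a\<close> brings the values into
    \<open>N'\<close> for every \<open>u\<close>, not only for those orthogonal to \<open>v\<close>.
    On the kernel of \<open>T\<close> the last two entries vanish, and the corrections with
    them.\<close>
  define T where "T u = ((\<beta> v u - G v u *\<^sub>R a, \<beta> v (J u) - G v (J u) *\<^sub>R a), (G v u, G v (J u)))" for u
  have linT: "linear T"
    by (rule linearI)
       (simp_all add: T_def J.add J.scaleR \<beta>.add_right \<beta>.scaleR_right G.add_right G.scaleR_right algebra_simps)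
  have b_in: "\<beta> v u - G v u *\<^sub>R a \<in> N'" for u
  proof -
    have "G v (u - G v u *\<^sub>R v) = 0" by (simp add: G.diff_right G.scaleR_right Gv)
    from first_order[OF this] have "L a (\<beta> v u - G v u *\<^sub>R a) = 0"
      by (simp add: \<beta>.diff_right \<beta>.scaleR_right a_def)
    then show ?thesis by (simp add: N'_def subspace_diff subspace_scale subspace_N \<beta>_N aN)
  qed
  \<comment> \<open>Since dim N' is at most dim N - 1, this target has dimension at most 2 dim N,
    which is less than \<open>DIM('e)\<close> by assumption.\<close>
  have "dim ((N' \<times> N') \<times> (UNIV :: (real \<times> real) set)) = 2 * dim N' + 2"
    using subN' by (simp add: dim_Times subspace_Times)
  then have "dim ((N' \<times> N') \<times> (UNIV :: (real \<times> real) set)) < DIM('e)"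
    using dimN' dim by simp
  then obtain u where u: "u \<noteq> 0" "T u = 0"
    using linear_kernel_of_range_dim_less[OF linT, of "(N' \<times> N') \<times> UNIV"] b_in by (auto simp: T_def)
  then have G0: "G v u = 0" "G v (J u) = 0" and \<beta>0: "\<beta> v u = 0" "\<beta> v (J u) = 0"
    by (auto simp: T_def zero_prod_def)
  \<comment> \<open>As \<open>\<beta> v u = 0\<close>, the linear and the cubic term of the quartic
    vanish, and the second order condition remains.\<close>
  have "2 * L a (\<beta> u u) - 2 * L a a * G u u \<ge> 0"
    by (rule quadratic_coeff_nonneg[of _ "L (\<beta> u u) (\<beta> u u) - L a a * (G u u)\<^sup>2"])
       (use quartic[OF G0(1)] in \<open>simp add: \<beta>0 L.zero_left L.zero_right\<close>)
  moreover have "L a (\<beta> u u) = 4 * G u u"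
    using L_\<beta>_\<beta>_eq[OF \<beta>0 G0] by (simp add: a_def Gv)
  moreover have "L a a * G u u > 4 * G u u"
    using a G_pos[OF u(1)] by simp
  ultimately show False by linarith
qed

end

section \<open>Gauss equation and parallel endomorphisms in a chart\<close>

lemma linear_sum_Basis:
  fixes f :: "'e::euclidean_space \<Rightarrow> 'f::real_vector"
  assumes "linear f"
  shows "f a = (\<Sum>c\<in>Basis. (a \<bullet> c) *\<^sub>R f c)"
proof -
  have "f a = f (\<Sum>c\<in>Basis. (a \<bullet> c) *\<^sub>R c)" by (simp add: euclidean_representation)
  also have "\<dots> = (\<Sum>c\<in>Basis. (a \<bullet> c) *\<^sub>R f c)"
    by (simp add: linear_sum[OF assms] linear_cmul[OF assms])
  finally show ?thesis .
qed

text \<open>A product rule for families known to be differentiable only at each fixed argument, such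
  as metrics, Christoffel symbols and \<open>J\<close> in a chart. Expanding the argument in the
  basis reduces it to the rule for scalar multiples.\<close>

lemma has_derivative_linear_family:
  fixes F :: "'x::real_normed_vector \<Rightarrow> 'e::euclidean_space \<Rightarrow> 'f::real_normed_vector"
  assumes S: "open S" "x \<in> S" and lin: "\<And>y. y \<in> S \<Longrightarrow> linear (F y)"
    and F': "\<And>a. ((\<lambda>y. F y a) has_derivative F' a) (at x)"
    and g: "(g has_derivative g') (at x)"
  shows "((\<lambda>y. F y (g y)) has_derivative (\<lambda>h. F' (g x) h + F x (g' h))) (at x)"
proof -
  have "((\<lambda>y. \<Sum>c\<in>Basis. (g x \<bullet> c) *\<^sub>R F y c) has_derivative (\<lambda>h. \<Sum>c\<in>Basis. (g x \<bullet> c) *\<^sub>R F' c h)) (at x)"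
    by (intro has_derivative_sum has_derivative_scaleR_right F')
  then have "((\<lambda>y. F y (g x)) has_derivative (\<lambda>h. \<Sum>c\<in>Basis. (g x \<bullet> c) *\<^sub>R F' c h)) (at x)"
    by (rule has_derivative_transform_within_open[OF _ S]) (metis linear_sum_Basis lin)
  then have F'_eq: "F' (g x) = (\<lambda>h. \<Sum>c\<in>Basis. (g x \<bullet> c) *\<^sub>R F' c h)"
    using has_derivative_unique F' by blast
  have "((\<lambda>y. \<Sum>c\<in>Basis. (g y \<bullet> c) *\<^sub>R F y c) has_derivative
      (\<lambda>h. \<Sum>c\<in>Basis. (g x \<bullet> c) *\<^sub>R F' c h + (g' h \<bullet> c) *\<^sub>R F x c)) (at x)"
    by (intro has_derivative_sum has_derivative_scaleR has_derivative_inner_left F' g)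
  then have "((\<lambda>y. \<Sum>c\<in>Basis. (g y \<bullet> c) *\<^sub>R F y c) has_derivative (\<lambda>h. F' (g x) h + F x (g' h))) (at x)"
    by (simp add: F'_eq sum.distrib linear_sum_Basis[OF lin[OF S(2)], of "g' _"])
  then show ?thesis
    by (rule has_derivative_transform_within_open[OF _ S]) (metis linear_sum_Basis lin)
qed

lemma positive_form_eqI:
  assumes "bounded_bilinear G" "\<And>u. u \<noteq> 0 \<Longrightarrow> G u u > (0::real)" "\<And>z. G a z = G b z"
  shows "a = b"
proof (rule ccontr)
  assume "a \<noteq> b"
  with assms(2)[of "a - b"] assms(3)[of "a - b"] bounded_bilinear.diff_left[OF assms(1)] show False
    by simp
qed

text \<open>\<open>T a\<close> lists the values of the functional \<open>G a\<close> on the basis;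
  definiteness makes \<open>T\<close> injective, hence surjective.\<close>

lemma positive_form_riesz:
  fixes G :: "'e::euclidean_space \<Rightarrow> 'e \<Rightarrow> real"
  assumes G: "bounded_bilinear G" and pos: "\<And>u. u \<noteq> 0 \<Longrightarrow> G u u > 0" and "linear \<rho>"
  obtains a where "\<And>z. G a z = \<rho> z"
proof -
  interpret G: bounded_bilinear G by (rule G)
  define T where "T a = (\<Sum>b\<in>Basis. G a b *\<^sub>R b)" for a
  have Tb: "T a \<bullet> b = G a b" if "b \<in> Basis" for a b
    using that by (simp add: T_def)
  have linT: "linear T"
    by (rule linearI) (simp_all add: T_def G.add_left G.scaleR_left scaleR_left.add sum.distrib scaleR_sum_right)
  have "T a = 0 \<Longrightarrow> a = 0" for a
  proof (rule positive_form_eqI[OF G pos])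
    fix z assume "T a = 0"
    then have "G a b = 0" if "b \<in> Basis" for b using Tb[OF that, of a] by simp
    then show "G a z = G 0 z"
      using linear_sum_Basis[of "G a" z] bounded_linear.linear[OF G.bounded_linear_right]
      by (simp add: G.zero_left)
  qed
  then have "surj T"
    using linT linear_injective_imp_surjective linear_injective_0 by blast
  then obtain a where a: "T a = (\<Sum>b\<in>Basis. \<rho> b *\<^sub>R b)" by (metis surjD)
  have "G a b = \<rho> b" if "b \<in> Basis" for b
    using Tb[OF that, of a] that by (simp add: a)
  then have "G a z = \<rho> z" for z
    using linear_sum_Basis[of "G a" z] linear_sum_Basis[OF \<open>linear \<rho>\<close>, of z]
      bounded_linear.linear[OF G.bounded_linear_right] by simp
  with that show ?thesis by blast
qed

text \<open>The inverse function theorem for \<open>(y, a) \<mapsto> (y, G y a)\<close>.\<close>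

lemma differentiable_riesz_representation:
  fixes G :: "'e::euclidean_space \<Rightarrow> 'e \<Rightarrow> 'e \<Rightarrow> real" and \<gamma> :: "'e \<Rightarrow> 'e"
  assumes S: "open S" "x \<in> S"
    and G: "\<And>y. y \<in> S \<Longrightarrow> bounded_bilinear (G y)" "\<And>y u. y \<in> S \<Longrightarrow> u \<noteq> 0 \<Longrightarrow> G y u u > 0"
    and G_diff: "\<And>y u v. y \<in> S \<Longrightarrow> (\<lambda>y. G y u v) differentiable (at y)"
    and \<gamma>: "\<And>y z. y \<in> S \<Longrightarrow> G y (\<gamma> y) z = \<rho> y z"
    and \<rho>_diff: "\<And>z. (\<lambda>y. \<rho> y z) differentiable (at x)"
  shows "\<gamma> differentiable (at x)"
proof -
  define T where "T y a = (\<Sum>b\<in>Basis. G y a b *\<^sub>R b)" for y a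
  define T' where "T' y a h = (\<Sum>b\<in>Basis. frechet_derivative (\<lambda>y. G y a b) (at y) h *\<^sub>R b)" for y a h
  define R where "R y = (\<Sum>b\<in>Basis. \<rho> y b *\<^sub>R b)" for y
  define \<Psi> where "\<Psi> = (\<lambda>(y, a). (y, T y a))"
  \<comment> \<open>\<open>g\<close> inverts \<open>\<Psi>\<close> over \<open>S\<close>, and
    \<open>\<gamma> y\<close> is the second component of \<open>g (y, R y)\<close>.\<close>
  define g where "g = (\<lambda>(y, r). (y, THE a. T y a = r))"
  have linT: "linear (T y)" if "y \<in> S" for y
    using G(1)[OF that]
    by (intro linearI) (simp_all add: T_def bounded_bilinear.add_left bounded_bilinear.scaleR_left
        scaleR_left.add sum.distrib scaleR_sum_right)
  have injT: "a = a'" if "y \<in> S" "T y a = T y a'" for y a a'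
  proof (rule positive_form_eqI[OF G(1,2)])
    fix z
    have "T y a \<bullet> b = T y a' \<bullet> b" for b using that by simp
    then have "G y a b = G y a' b" if "b \<in> Basis" for b
      using that by (metis (no_types) T_def inner_sum_left_Basis)
    then show "G y a z = G y a' z"
      using linear_sum_Basis[of "G y a" z] linear_sum_Basis[of "G y a'" z]
        bounded_linear.linear[OF bounded_bilinear.bounded_linear_right[OF G(1)[OF that(1)]]] by simp
  qed (use that in auto)
  have surjT: "\<exists>a. T y a = r" if "y \<in> S" for y r
  proof -
    have "inj (T y)" using injT[OF that] by (auto simp: inj_def)
    then have "surj (T y)" using linT[OF that] linear_injective_imp_surjective by blast
    then show ?thesis by (metis surjD)
  qed
  have T_der: "((\<lambda>y. T y a) has_derivative T' y a) (at y)" if "y \<in> S" for y a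
    unfolding T_def T'_def using G_diff[OF that]
    by (intro has_derivative_sum has_derivative_scaleR_left) (simp add: frechet_derivative_works)
  have \<Psi>_der: "(\<Psi> has_derivative (\<lambda>h. (fst h, T' y a (fst h) + T y (snd h)))) (at (y, a))"
    if "y \<in> S" for y a
  proof -
    have "((\<lambda>p. T (fst p) (snd p)) has_derivative (\<lambda>h. T' (fst (y, a)) (snd (y, a)) (fst h) + T (fst (y, a)) (snd h))) (at (y, a))"
    proof (rule has_derivative_linear_family[where S = "S \<times> UNIV" and F = "\<lambda>p. T (fst p)"
          and F' = "\<lambda>c h. T' (fst (y, a)) c (fst h)"])
      show "((\<lambda>p. T (fst p) c) has_derivative (\<lambda>h. T' (fst (y, a)) c (fst h))) (at (y, a))" for c
        by (rule has_derivative_compose[OF has_derivative_fst[OF has_derivative_ident]])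
           (simp add: T_der that)
    qed (use S that linT in \<open>auto intro: open_Times has_derivative_snd[OF has_derivative_ident]\<close>)
    then show ?thesis
      unfolding \<Psi>_def case_prod_unfold
      by (intro has_derivative_Pair has_derivative_fst[OF has_derivative_ident]) simp
  qed
  define a where "a = \<gamma> x"
  define \<Psi>' where "\<Psi>' = (\<lambda>h::'e \<times> 'e. (fst h, T' x a (fst h) + T x (snd h)))"
  define g' where "g' = (\<lambda>(h, r). (h, SOME b. T x b = r - T' x a h))"
  have "(g has_derivative g') (at (\<Psi> (x, a)))"
  proof (rule has_derivative_inverse_strong[where f = \<Psi> and x = "(x, a)" and f' = \<Psi>'])
    show "open (S \<times> (UNIV :: 'e set))" "(x, a) \<in> S \<times> UNIV" using S by (auto intro: open_Times)
    show "continuous_on (S \<times> UNIV) \<Psi>"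
      using \<Psi>_der has_derivative_continuous
      by (intro continuous_at_imp_continuous_on) blast
    show "g (\<Psi> p) = p" if "p \<in> S \<times> UNIV" for p
      using that injT by (auto simp: g_def \<Psi>_def)
    show "(\<Psi> has_derivative \<Psi>') (at (x, a))"
      unfolding \<Psi>'_def using \<Psi>_der S by blast
    have "T x (SOME b. T x b = r) = r" for r
      using someI_ex[OF surjT[OF S(2)]] .
    then show "\<Psi>' \<circ> g' = id"
      by (auto simp: \<Psi>'_def g'_def fun_eq_iff)
  qed
  moreover have "\<Psi> (x, a) = (x, R x)"
    using \<gamma> S by (simp add: \<Psi>_def T_def R_def a_def)
  ultimately have g_der: "(g has_derivative g') (at (x, R x))" by simp
  have "R differentiable (at x)"
    unfolding R_def using \<rho>_diff by (intro differentiable_sum differentiable_scaleR) auto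
  then obtain R' where R': "(R has_derivative R') (at x)" by (auto simp: differentiable_def)
  have "((\<lambda>y. snd (g (y, R y))) has_derivative (\<lambda>h. snd (g' (h, R' h)))) (at x)"
    by (intro has_derivative_snd has_derivative_compose[of "\<lambda>y. (y, R y)" _ x _ g, OF _ g_der]
        has_derivative_Pair has_derivative_ident R')
  then have "(\<gamma> has_derivative (\<lambda>h. snd (g' (h, R' h)))) (at x)"
  proof (rule has_derivative_transform_within_open[OF _ S])
    fix y assume y: "y \<in> S"
    have "T y (\<gamma> y) = R y" using \<gamma>[OF y] by (simp add: T_def R_def)
    then show "snd (g (y, R y)) = \<gamma> y"
      using injT[OF y] by (auto simp: g_def intro!: the_equality)
  qed
  then show ?thesis by (auto simp: differentiable_def)
qed

text \<open>The form \<open>L\<close> may be indefinite, as in Lorentz space; positivity is asked of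
  the induced metric. Three derivatives of \<open>\<Phi>\<close> enter because the curvature
  differentiates the Christoffel symbols, which contain second derivatives.\<close>

locale isometric_parametrization =
  L: bounded_bilinear L
  for L :: "'w::euclidean_space \<Rightarrow> 'w \<Rightarrow> real" +
  fixes S :: "'e::euclidean_space set" and \<Phi> :: "'e \<Rightarrow> 'w" and G :: "'e \<Rightarrow> 'e \<Rightarrow> 'e \<Rightarrow> real"
  assumes L_sym: "L a b = L b a"
    and open_S: "open S" and \<Phi>_C3: "Ck_on (Suc (Suc (Suc 0))) S \<Phi>"
    and G_eq: "y \<in> S \<Longrightarrow> G y u v = L (frechet_derivative \<Phi> (at y) u) (frechet_derivative \<Phi> (at y) v)"
    and G_pos: "y \<in> S \<Longrightarrow> u \<noteq> 0 \<Longrightarrow> G y u u > 0"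
begin

definition D where "D y u = frechet_derivative \<Phi> (at y) u"
definition D2 where "D2 y u v = frechet_derivative (\<lambda>z. D z v) (at y) u"
definition D3 where "D3 y u v w = frechet_derivative (\<lambda>z. D2 z v w) (at y) u"

lemma \<Phi>_der: "y \<in> S \<Longrightarrow> (\<Phi> has_derivative D y) (at y)"
  using \<Phi>_C3 by (simp add: D_def[abs_def] frechet_derivative_works)

lemma D_der: "y \<in> S \<Longrightarrow> ((\<lambda>z. D z v) has_derivative (\<lambda>u. D2 y u v)) (at y)"
  using \<Phi>_C3 by (simp add: D2_def[abs_def] D_def[abs_def] frechet_derivative_works)

lemma D2_der: "y \<in> S \<Longrightarrow> ((\<lambda>z. D2 z v w) has_derivative (\<lambda>u. D3 y u v w)) (at y)"
  using \<Phi>_C3 by (simp add: D3_def[abs_def] D2_def[abs_def] D_def[abs_def] frechet_derivative_works)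

lemma D2_sym: "y \<in> S \<Longrightarrow> D2 y u v = D2 y v u"
  using Ck_on_second_derivative_symmetric[OF open_S _ Ck_on_Suc_imp[OF \<Phi>_C3]]
  by (simp add: D2_def D_def)

text \<open>Symmetry of the second derivative of \<open>D y w\<close> in \<open>y\<close>. It
  removes the third derivatives of \<open>\<Phi>\<close> from the curvature.\<close>

lemma D3_sym: "y \<in> S \<Longrightarrow> D3 y u v w = D3 y v u w"
  using Ck_on_second_derivative_symmetric[OF open_S, of y 0 "\<lambda>y. D y w"] \<Phi>_C3
  by (simp add: D3_def D2_def D_def)

lemma linear_D: "y \<in> S \<Longrightarrow> linear (D y)"
  using \<Phi>_der has_derivative_linear by blast

lemma linear_D2_left: "y \<in> S \<Longrightarrow> linear (\<lambda>u. D2 y u v)"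
  using D_der has_derivative_linear by blast

lemma bilinear_D2: "y \<in> S \<Longrightarrow> bilinear (D2 y)"
  using linear_D2_left D2_sym unfolding bilinear_def by (metis (no_types, lifting) ext)

lemma G_D: "y \<in> S \<Longrightarrow> G y u v = L (D y u) (D y v)"
  by (simp add: G_eq D_def)

lemma G_sym: "y \<in> S \<Longrightarrow> G y u v = G y v u"
  by (simp add: G_D L_sym)

lemma bounded_bilinear_G: "y \<in> S \<Longrightarrow> bounded_bilinear (G y)"
proof -
  assume y: "y \<in> S"
  have "bounded_linear (D y)" using linear_D[OF y] by (simp add: linear_conv_bounded_linear)
  then have "bounded_bilinear (\<lambda>u v. L (D y u) (D y v))" by (intro L.comp)
  then show ?thesis using G_D[OF y] by (metis (no_types, lifting) ext)
qed

lemma G_der: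
  assumes "y \<in> S"
  shows "((\<lambda>z. G z v w) has_derivative (\<lambda>u. L (D y v) (D2 y u w) + L (D2 y u v) (D y w))) (at y)"
proof -
  have "((\<lambda>z. L (D z v) (D z w)) has_derivative (\<lambda>u. L (D y v) (D2 y u w) + L (D2 y u v) (D y w))) (at y)"
    by (intro L.FDERIV D_der assms)
  then show ?thesis
    by (rule has_derivative_transform_within_open[OF _ open_S assms]) (simp add: G_D)
qed

text \<open>The vector representing the tangential part of \<open>D2 y u v\<close> satisfies the
  defining conditions by the product rule for the metric. Uniqueness is the argument behind the
  Koszul formula.\<close>

lemma christoffel_char:
  assumes y: "y \<in> S"
  shows "bilinear (christoffel G y)"
    and "christoffel G y u v = christoffel G y v u"
    and "G y (christoffel G y u v) z = L (D2 y u v) (D y z)"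
proof -
  interpret G: bounded_bilinear "G y" by (rule bounded_bilinear_G[OF y])
  have "\<exists>a. \<forall>z. G y a z = L (D2 y u v) (D y z)" for u v
  proof -
    have "linear (\<lambda>z. L (D2 y u v) (D y z))"
      by (rule linearI) (simp_all add: linear_add[OF linear_D[OF y]] linear_cmul[OF linear_D[OF y]] L.add_right L.scaleR_right)
    from positive_form_riesz[OF G.bounded_bilinear_axioms G_pos[OF y] this] show ?thesis by blast
  qed
  then obtain \<Gamma> where \<Gamma>: "\<And>u v z. G y (\<Gamma> u v) z = L (D2 y u v) (D y z)" by metis
  note eqI = positive_form_eqI[OF G.bounded_bilinear_axioms G_pos[OF y]]
  have \<Gamma>_sym: "\<Gamma> u v = \<Gamma> v u" for u v by (rule eqI) (simp_all add: \<Gamma> D2_sym[OF y])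
  have lin: "linear (\<lambda>u. \<Gamma> u v)" for v
    by (rule linearI; rule eqI)
      (simp_all add: \<Gamma> G.add_left G.scaleR_left L.add_left L.scaleR_left
        linear_add[OF linear_D2_left[OF y]] linear_cmul[OF linear_D2_left[OF y]])
  then have bil: "bilinear \<Gamma>"
    using \<Gamma>_sym unfolding bilinear_def by (metis (no_types, lifting) ext)
  have dG: "frechet_derivative (\<lambda>z. G z v w) (at y) u = G y (\<Gamma> u v) w + G y v (\<Gamma> u w)" for u v w
    unfolding frechet_derivative_at[OF G_der[OF y, of v w], symmetric]
    by (simp add: \<Gamma> G_sym[OF y, of v] L_sym)
  have "christoffel G y = \<Gamma>"
    unfolding christoffel_def
  proof (rule the_equality)
    show "bilinear \<Gamma> \<and> (\<forall>u v. \<Gamma> u v = \<Gamma> v u) \<and>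
      (\<forall>u v w. frechet_derivative (\<lambda>z. G z v w) (at y) u = G y (\<Gamma> u v) w + G y v (\<Gamma> u w))"
      using bil \<Gamma>_sym dG by blast
    fix \<Gamma>' assume \<Gamma>': "bilinear \<Gamma>' \<and> (\<forall>u v. \<Gamma>' u v = \<Gamma>' v u) \<and>
      (\<forall>u v w. frechet_derivative (\<lambda>z. G z v w) (at y) u = G y (\<Gamma>' u v) w + G y v (\<Gamma>' u w))"
    define d where "d u v w = G y (\<Gamma>' u v) w - G y (\<Gamma> u v) w" for u v w
    have "d u v w = d v u w" "d u v w = - d u w v" for u v w
    proof -
      show "d u v w = d v u w" using \<Gamma>' \<Gamma>_sym by (simp add: d_def)
      have "G y (\<Gamma>' u v) w + G y v (\<Gamma>' u w) = G y (\<Gamma> u v) w + G y v (\<Gamma> u w)"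
        using \<Gamma>' dG by metis
      then show "d u v w = - d u w v" by (simp add: d_def G_sym[OF y, of v])
    qed
    \<comment> \<open>A trilinear expression symmetric in its first two and skew in its last two
      arguments returns to its own negative after six alternating swaps.\<close>
    then have "d u v w = 0" for u v w
      by (smt (verit))
    then show "\<Gamma>' = \<Gamma>" by (intro ext eqI) (simp_all add: d_def)
  qed
  with bil \<Gamma>_sym \<Gamma> show "bilinear (christoffel G y)" "christoffel G y u v = christoffel G y v u"
    "G y (christoffel G y u v) z = L (D2 y u v) (D y z)" by simp_all
qed

lemma christoffel_der:
  assumes "y \<in> S"
  shows "((\<lambda>z. christoffel G z v w) has_derivative frechet_derivative (\<lambda>z. christoffel G z v w) (at y)) (at y)"
  unfolding frechet_derivative_works[symmetric]
proof (rule differentiable_riesz_representation[OF open_S assms, where G = G and \<rho> = "\<lambda>y z. L (D2 y v w) (D y z)"])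
  show "(\<lambda>y. G y u v) differentiable at z" if "z \<in> S" for z u v
    using G_der[OF that] by (auto simp: differentiable_def)
  show "(\<lambda>y. L (D2 y v w) (D y z)) differentiable at y" for z
    using L.FDERIV[OF D2_der[OF assms] D_der[OF assms]] by (auto simp: differentiable_def)
qed (simp_all add: bounded_bilinear_G G_pos christoffel_char)

text \<open>The form relative to the flat ambient space. For a map into the hyperboloid it still has
  a component along the position vector.\<close>

definition second_fundamental_form where
  "second_fundamental_form y u v = D2 y u v - D y (christoffel G y u v)"

lemma second_fundamental_form_normal:
  "y \<in> S \<Longrightarrow> L (second_fundamental_form y u v) (D y z) = 0"
  by (simp add: second_fundamental_form_def L.diff_left christoffel_char flip: G_D)

text \<open>Differentiating G(\<Gamma>(v, w), z) = L(D2 v w, D z) expresses the derivatives of the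
  Christoffel symbols through \<open>D3\<close>, \<open>D2\<close> and \<Gamma>. Antisymmetrising in
  \<open>u\<close> and \<open>v\<close> cancels \<open>D3\<close> and the iterated \<Gamma>, and
  leaves products of normal parts.\<close>

lemma gauss_equation:
  assumes x: "x \<in> S"
  shows "G x (local_curvature G x u v w) z =
      L (second_fundamental_form x v w) (second_fundamental_form x u z)
    - L (second_fundamental_form x u w) (second_fundamental_form x v z)"
proof -
  interpret G: bounded_bilinear "G x" by (rule bounded_bilinear_G[OF x])
  let ?\<Gamma> = "christoffel G x"
  define D\<Gamma> where "D\<Gamma> h v w = frechet_derivative (\<lambda>y. christoffel G y v w) (at x) h" for h v w
  have D\<Gamma>: "G x (D\<Gamma> h v w) z = L (D3 x h v w) (D x z) + L (D2 x v w) (D2 x h z)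
      - G x (?\<Gamma> h (?\<Gamma> v w)) z - G x (?\<Gamma> v w) (?\<Gamma> h z)" for h v w
  proof -
    have "((\<lambda>y. G y (christoffel G y v w) z) has_derivative
        (\<lambda>h. (L (D x (?\<Gamma> v w)) (D2 x h z) + L (D2 x h (?\<Gamma> v w)) (D x z)) + G x (D\<Gamma> h v w) z)) (at x)"
    proof (rule has_derivative_linear_family[OF open_S x, of "\<lambda>y a. G y a z"])
      show "linear (\<lambda>a. G y a z)" if "y \<in> S" for y
        using bounded_bilinear.bounded_linear_left[OF bounded_bilinear_G[OF that]] bounded_linear.linear by blast
    qed (simp_all add: G_der x christoffel_der D\<Gamma>_def)
    moreover have "((\<lambda>y. G y (christoffel G y v w) z) has_derivative
        (\<lambda>h. L (D2 x v w) (D2 x h z) + L (D3 x h v w) (D x z))) (at x)"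
      by (rule has_derivative_transform_within_open[OF L.FDERIV[OF D2_der[OF x] D_der[OF x]] open_S x])
         (simp add: christoffel_char)
    ultimately have "(L (D x (?\<Gamma> v w)) (D2 x h z) + L (D2 x h (?\<Gamma> v w)) (D x z)) + G x (D\<Gamma> h v w) z
        = L (D2 x v w) (D2 x h z) + L (D3 x h v w) (D x z)"
      by (rule has_derivative_unique[THEN fun_cong])
    moreover have "L (D x (?\<Gamma> v w)) (D2 x h z) = G x (?\<Gamma> v w) (?\<Gamma> h z)"
      by (metis christoffel_char(3)[OF x] G_sym[OF x] L_sym)
    moreover have "L (D2 x h (?\<Gamma> v w)) (D x z) = G x (?\<Gamma> h (?\<Gamma> v w)) z"
      by (simp add: christoffel_char(3)[OF x])
    ultimately show ?thesis by linarith
  qed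
  \<comment> \<open>Removing tangential parts: the form is normal to \<open>D x\<close>, and pairing
    \<open>D2\<close> with a tangent vector gives \<Gamma>.\<close>
  have A: "L (second_fundamental_form x v w) (second_fundamental_form x u z)
      = L (D2 x v w) (D2 x u z) - G x (?\<Gamma> v w) (?\<Gamma> u z)" for u v w z
  proof -
    have "L (D x (?\<Gamma> v w)) (D2 x u z) = G x (?\<Gamma> v w) (?\<Gamma> u z)"
      by (metis christoffel_char(3)[OF x] G_sym[OF x] L_sym)
    moreover have "L (second_fundamental_form x v w) (second_fundamental_form x u z)
        = L (second_fundamental_form x v w) (D2 x u z)"
      using second_fundamental_form_normal[OF x, of v w "?\<Gamma> u z"]
      by (simp add: second_fundamental_form_def[of x u z] L.diff_right)
    ultimately show ?thesis
      by (simp add: second_fundamental_form_def[of x v w] L.diff_left)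
  qed
  show ?thesis
    unfolding local_curvature_def D\<Gamma>_def[symmetric] A
    by (simp add: G.add_left G.diff_left D\<Gamma> D3_sym[OF x, of u v])
qed

text \<open>The parallelism equation prescribes the first derivative of \<open>J z w\<close>. Its
  integrability condition, the symmetry of the second derivative, says that the curvature commutes
  with \<open>J\<close>.\<close>

lemma local_curvature_parallel:
  assumes x: "x \<in> S"
    and J_lin: "\<And>y. y \<in> S \<Longrightarrow> linear (J y)"
    and J_diff: "\<And>y v. y \<in> S \<Longrightarrow> (\<lambda>z. J z v) differentiable (at y)"
    and par: "\<And>y u v. y \<in> S \<Longrightarrow> frechet_derivative (\<lambda>z. J z v) (at y) u
       + christoffel G y u (J y v) - J y (christoffel G y u v) = 0"
  shows "local_curvature G x u v (J x w) = J x (local_curvature G x u v w)"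
proof -
  let ?\<Gamma> = "christoffel G"
  define D\<Gamma> where "D\<Gamma> h v w = frechet_derivative (\<lambda>y. ?\<Gamma> y v w) (at x) h" for h v w
  have J_der: "((\<lambda>z. J z v) has_derivative (\<lambda>u. J y (?\<Gamma> y u v) - ?\<Gamma> y u (J y v))) (at y)" if "y \<in> S" for y v
  proof -
    have "frechet_derivative (\<lambda>z. J z v) (at y) = (\<lambda>u. J y (?\<Gamma> y u v) - ?\<Gamma> y u (J y v))"
      using par[OF that] by (auto simp: fun_eq_iff algebra_simps)
    with J_diff[OF that, of v] show ?thesis unfolding frechet_derivative_works by simp
  qed
  have lin\<Gamma>: "linear (?\<Gamma> y u)" if "y \<in> S" for y u
    using christoffel_char(1)[OF that] by (simp add: bilinear_def)
  \<comment> \<open>The formula of \<open>J_der\<close> is differentiated once more, and each new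
    derivative of \<open>J\<close> is again replaced by that formula.\<close>
  have der2: "((\<lambda>y. J y (?\<Gamma> y u w) - ?\<Gamma> y u (J y w)) has_derivative
      (\<lambda>h. ((J x (?\<Gamma> x h (?\<Gamma> x u w)) - ?\<Gamma> x h (J x (?\<Gamma> x u w))) + J x (D\<Gamma> h u w))
         - (D\<Gamma> h u (J x w) + ?\<Gamma> x u (J x (?\<Gamma> x h w) - ?\<Gamma> x h (J x w))))) (at x)" for u
    unfolding D\<Gamma>_def
    by (intro has_derivative_diff has_derivative_linear_family[OF open_S x] J_lin lin\<Gamma>
        J_der[OF x] christoffel_der[OF x])
  note sub = linear_diff[OF lin\<Gamma>[OF x]] linear_diff[OF J_lin[OF x]] linear_add[OF J_lin[OF x]]
  show ?thesis
    using second_derivative_symmetric[OF open_S x J_der der2 der2, of u v]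
    unfolding local_curvature_def D\<Gamma>_def[symmetric]
    by (simp add: sub algebra_simps)
qed

end

section \<open>Kaehler submanifolds of the hyperboloid\<close>

lemma bounded_bilinear_lorentz: "bounded_bilinear (lorentz :: real \<times> 'h::euclidean_space \<Rightarrow> _)"
  unfolding bilinear_conv_bounded_bilinear[symmetric] bilinear_def
  by (auto intro!: linearI simp: lorentz_def algebra_simps)

lemma lorentz_commute: "lorentz p q = lorentz q p"
  by (simp add: lorentz_def inner_commute)

text \<open>Cauchy-Schwarz for the spatial parts, with |snd p|^2 = (fst p)^2 - 1: the orthogonal
  complement of a timelike vector is spacelike.\<close>

lemma lorentz_pos_on_orthogonal:
  assumes p: "lorentz p p = -1" and a: "lorentz a p = 0" "a \<noteq> 0"
  shows "lorentz a a > 0"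
proof -
  have t: "(fst p)\<^sup>2 = 1 + snd p \<bullet> snd p" using p by (simp add: lorentz_def power2_eq_square)
  then have tpos: "(fst p)\<^sup>2 > 0" by (smt (verit) inner_ge_zero)
  have eq: "snd a \<bullet> snd p = fst a * fst p" using a(1) by (simp add: lorentz_def)
  have "snd a \<noteq> 0"
  proof
    assume "snd a = 0"
    with eq tpos have "fst a = 0" by auto
    with \<open>snd a = 0\<close> a(2) show False by (simp add: prod_eq_iff)
  qed
  then have "0 < snd a \<bullet> snd a" by simp
  also have "\<dots> \<le> (fst p)\<^sup>2 * (snd a \<bullet> snd a) - (fst a * fst p)\<^sup>2"
    using Cauchy_Schwarz_ineq[of "snd a" "snd p"] unfolding eq by (simp add: t algebra_simps)
  also have "\<dots> = (fst p)\<^sup>2 * lorentz a a"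
    by (simp add: lorentz_def power2_eq_square algebra_simps)
  finally show ?thesis using tpos by (simp add: zero_less_mult_iff)
qed

text \<open>The position vector and the tangent space span \<open>DIM('e) + 1\<close> of the
  \<open>DIM('h) + 1\<close> dimensions, so the normal space \<open>N\<close> inside the hyperboloid
  has dimension \<open>DIM('h) - DIM('e)\<close>, to which \<open>codimension_bound\<close>
  applies.\<close>

lemma kaehler_parametrization_codimension:
  fixes \<Phi> :: "'e::euclidean_space \<Rightarrow> real \<times> 'h::euclidean_space"
  assumes param: "isometric_parametrization lorentz S \<Phi> G"
    and x: "x \<in> S" and hyp: "\<And>y. y \<in> S \<Longrightarrow> lorentz (\<Phi> y) (\<Phi> y) = -1"
    and J_lin: "\<And>y. y \<in> S \<Longrightarrow> linear (J y)"
    and J_diff: "\<And>y v. y \<in> S \<Longrightarrow> (\<lambda>z. J z v) differentiable (at y)"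
    and par: "\<And>y u v. y \<in> S \<Longrightarrow> frechet_derivative (\<lambda>z. J z v) (at y) u
       + christoffel G y u (J y v) - J y (christoffel G y u v) = 0"
    and J_J: "\<And>u. J x (J x u) = - u" and G_J: "\<And>u v. G x (J x u) (J x v) = G x u v"
    and pos: "\<And>u. u \<noteq> 0 \<Longrightarrow> G x (local_curvature G x u (J x u) (J x u)) u > 0"
  shows "3 * DIM('e) \<le> 2 * DIM('h)"
proof -
  interpret isometric_parametrization lorentz S \<Phi> G by (rule param)
  interpret Gx: bounded_bilinear "G x" by (rule bounded_bilinear_G[OF x])
  have \<Phi>_D: "lorentz (\<Phi> y) (D y u) = 0" if "y \<in> S" for y u
  proof -
    have "((\<lambda>y. lorentz (\<Phi> y) (\<Phi> y)) has_derivative (\<lambda>u. lorentz (\<Phi> y) (D y u) + lorentz (D y u) (\<Phi> y))) (at y)"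
      by (intro L.FDERIV \<Phi>_der that)
    moreover have "((\<lambda>y. lorentz (\<Phi> y) (\<Phi> y)) has_derivative (\<lambda>u. 0)) (at y)"
      by (rule has_derivative_transform_within_open[OF has_derivative_const open_S that]) (simp add: hyp)
    ultimately have "lorentz (\<Phi> y) (D y u) + lorentz (D y u) (\<Phi> y) = 0"
      by (rule has_derivative_unique[THEN fun_cong])
    then show ?thesis by (simp add: lorentz_commute)
  qed
  \<comment> \<open>The orthogonality of position and tangent vectors is differentiated once
    more.\<close>
  have \<Phi>_D2: "lorentz (\<Phi> x) (D2 x u v) = - G x u v" for u v
  proof -
    have "((\<lambda>y. lorentz (\<Phi> y) (D y v)) has_derivative (\<lambda>u. lorentz (\<Phi> x) (D2 x u v) + lorentz (D x u) (D x v))) (at x)"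
      by (intro L.FDERIV \<Phi>_der D_der x)
    moreover have "((\<lambda>y. lorentz (\<Phi> y) (D y v)) has_derivative (\<lambda>u. 0)) (at x)"
      by (rule has_derivative_transform_within_open[OF has_derivative_const open_S x]) (simp add: \<Phi>_D)
    ultimately have "lorentz (\<Phi> x) (D2 x u v) + lorentz (D x u) (D x v) = 0"
      by (rule has_derivative_unique[THEN fun_cong])
    then show ?thesis by (simp add: G_D[OF x])
  qed
  define N where "N = {a. lorentz a (\<Phi> x) = 0 \<and> (\<forall>u. lorentz a (D x u) = 0)}"
  \<comment> \<open>The component along \<open>\<Phi> x\<close> is projected out, with the sign
    dictated by <\<Phi>, \<Phi>> = -1. In the Gauss equation this produces the terms of ambient
    curvature -1.\<close>
  define \<alpha> where "\<alpha> u v = second_fundamental_form x u v - G x u v *\<^sub>R \<Phi> x" for u v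
  have A_\<Phi>: "lorentz (second_fundamental_form x u v) (\<Phi> x) = - G x u v" for u v
    by (simp add: second_fundamental_form_def lorentz_commute[of _ "\<Phi> x"] L.diff_right \<Phi>_D[OF x] \<Phi>_D2)
  have A_A: "lorentz (second_fundamental_form x u v) (second_fundamental_form x w z)
      = lorentz (\<alpha> u v) (\<alpha> w z) - G x u v * G x w z" for u v w z
    by (simp add: \<alpha>_def L.diff_left L.diff_right L.scaleR_left L.scaleR_right A_\<Phi>
        lorentz_commute[of "\<Phi> x" "second_fundamental_form x w z"] hyp[OF x])
  have bil_D2: "bilinear (D2 x)" and bil_c: "bilinear (christoffel G x)"
    using bilinear_D2[OF x] christoffel_char(1)[OF x] by auto
  have bil_\<alpha>: "bounded_bilinear \<alpha>"
    unfolding bilinear_conv_bounded_bilinear[symmetric] bilinear_def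
    using linear_D[OF x]
    by (auto intro!: linearI simp: \<alpha>_def second_fundamental_form_def
        bilinear_ladd[OF bil_D2] bilinear_radd[OF bil_D2] bilinear_lmul[OF bil_D2] bilinear_rmul[OF bil_D2]
        bilinear_ladd[OF bil_c] bilinear_radd[OF bil_c] bilinear_lmul[OF bil_c] bilinear_rmul[OF bil_c]
        linear_add linear_cmul Gx.add_left Gx.add_right Gx.scaleR_left Gx.scaleR_right algebra_simps)
  have sub_N: "subspace N"
    by (auto simp: N_def subspace_def L.zero_left L.add_left L.scaleR_left)
  interpret K: kaehler_second_fundamental_form "G x" lorentz \<alpha> "J x" N
      "\<lambda>u v w z. G x (local_curvature G x u v w) z"
  proof (intro kaehler_second_fundamental_form.intro kaehler_second_fundamental_form_axioms.intro)
    show "bounded_linear (J x)" using J_lin[OF x] by (simp add: linear_conv_bounded_linear)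
    show "lorentz a a > 0" if "a \<in> N" "a \<noteq> 0" for a
      using that lorentz_pos_on_orthogonal[OF hyp[OF x]] by (simp add: N_def)
    show "\<alpha> u v \<in> N" for u v
      using second_fundamental_form_normal[OF x] A_\<Phi>
      by (simp add: N_def \<alpha>_def L.diff_left L.scaleR_left hyp[OF x] \<Phi>_D[OF x])
    show "\<alpha> u v = \<alpha> v u" for u v
      by (simp add: \<alpha>_def second_fundamental_form_def D2_sym[OF x, of u v] G_sym[OF x, of u v]
          christoffel_char(2)[OF x, of u v])
    show "G x (local_curvature G x u v w) z = lorentz (\<alpha> v w) (\<alpha> u z) - lorentz (\<alpha> u w) (\<alpha> v z)
        - G x v w * G x u z + G x u w * G x v z" for u v w z
      by (simp add: gauss_equation[OF x] A_A)
    show "G x (local_curvature G x u v (J x w)) (J x z) = G x (local_curvature G x u v w) z" for u v w z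
      using local_curvature_parallel[OF x J_lin J_diff par] by (simp add: G_J)
    show "G x (local_curvature G x u (J x u) (J x u)) u > 0" if "u \<noteq> 0" for u
      by (rule pos[OF that])
  qed (simp_all add: bounded_bilinear_lorentz lorentz_commute Gx.bounded_bilinear_axioms bil_\<alpha> sub_N
      G_sym[OF x] G_pos[OF x] J_J G_J)
  \<comment> \<open>\<open>Q\<close> turns Lorentz orthogonality into Euclidean orthogonality, for
    which the dimension formula for complements is available.\<close>
  define Q :: "real \<times> 'h \<Rightarrow> real \<times> 'h" where "Q p = (- fst p, snd p)" for p
  have Q: "lorentz a b = Q b \<bullet> a" for a b
    by (simp add: lorentz_def Q_def inner_prod_def inner_commute)
  define T where "T = (\<lambda>(c, u). Q (c *\<^sub>R \<Phi> x + D x u))"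
  have linT: "linear T"
    using linear_D[OF x]
    by (auto intro!: linearI simp: T_def Q_def linear_add linear_cmul algebra_simps)
  have "p = 0" if "T p = 0" for p
  proof -
    obtain c u where p: "p = (c, u)" by (cases p)
    have 0: "c *\<^sub>R \<Phi> x + D x u = 0" using that by (simp add: p T_def Q_def prod_eq_iff)
    have "lorentz (\<Phi> x) (c *\<^sub>R \<Phi> x + D x u) = - c"
      by (simp add: L.add_right L.scaleR_right hyp[OF x] \<Phi>_D[OF x])
    then have c: "c = 0" using 0 by (simp add: L.zero_right)
    then have "G x u u = 0" using 0 by (simp add: G_D[OF x] L.zero_right)
    then show "p = 0" using G_pos[OF x, of u] c p by (cases "u = 0") (auto simp: zero_prod_def)
  qed
  then have "inj T" using linear_injective_0[OF linT] by blast
  then have dimT: "dim (range T) = DIM('e) + 1"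
    using dim_image_eq[OF linT, of UNIV] by simp
  have "N = {a \<in> UNIV. \<forall>b \<in> range T. orthogonal b a}"
  proof (intro set_eqI iffI)
    fix a assume "a \<in> N"
    then show "a \<in> {a \<in> UNIV. \<forall>b \<in> range T. orthogonal b a}"
      by (auto simp: N_def T_def orthogonal_def L.add_right L.scaleR_right simp flip: Q)
  next
    fix a assume "a \<in> {a \<in> UNIV. \<forall>b \<in> range T. orthogonal b a}"
    then have "T p \<bullet> a = 0" for p by (metis (lifting) mem_Collect_eq orthogonal_def rangeI)
    from this[of "(1, 0)"] this[of "(0, _)"] show "a \<in> N"
      using linear_0[OF linear_D[OF x]] by (simp add: N_def T_def flip: Q)
  qed
  then have "dim N + dim (range T) = DIM('h) + 1"
    using dim_subspace_orthogonal_to_vectors[of "range T" UNIV] linear_subspace_image[OF linT, of UNIV]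
    by simp
  then show ?thesis using K.codimension_bound dimT by linarith
qed

section \<open>Charts and tangent vectors\<close>

lemma smooth_on_imp_Ck_on: "smooth_on S f \<Longrightarrow> Ck_on k S f"
  by (simp add: smooth_on_def)

lemma smooth_on_differentiable: "smooth_on S f \<Longrightarrow> x \<in> S \<Longrightarrow> f differentiable (at x)"
  using smooth_on_imp_Ck_on[of S f "Suc 0"] by simp

locale manifold_charts =
  fixes M :: "('a, 'e::euclidean_space) riemannian"
  assumes manifold: "smooth_manifold M"
begin

lemma charts_atD: "c \<in> charts_at M p \<Longrightarrow> c \<in> atlas M" "c \<in> charts_at M p \<Longrightarrow> p \<in> fst c"
  by (auto simp: charts_at_def)

lemma charts_at_nonempty: "p \<in> topspace (mtop M) \<Longrightarrow> charts_at M p \<noteq> {}"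
proof -
  assume "p \<in> topspace (mtop M)"
  then have "p \<in> (\<Union>c\<in>atlas M. fst c)" using manifold by (simp add: smooth_manifold_def)
  then show ?thesis by (auto simp: charts_at_def)
qed

lemma chart_homeomorphic:
  "c \<in> atlas M \<Longrightarrow> homeomorphic_map (subtopology (mtop M) (fst c)) (top_of_set (snd c ` fst c)) (snd c)"
  using manifold by (simp add: smooth_manifold_def)

lemma chart_openin: "c \<in> atlas M \<Longrightarrow> openin (mtop M) (fst c)"
  using manifold by (simp add: smooth_manifold_def)

lemma chart_subset_topspace: "c \<in> atlas M \<Longrightarrow> fst c \<subseteq> topspace (mtop M)"
  using chart_openin openin_subset by blast

lemma chart_image_open: "c \<in> atlas M \<Longrightarrow> open (snd c ` fst c)"
  using manifold by (simp add: smooth_manifold_def)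

lemma chart_inj: "c \<in> atlas M \<Longrightarrow> inj_on (snd c) (fst c)"
  using homeomorphic_imp_injective_map[OF chart_homeomorphic[of c]] chart_subset_topspace[of c]
  by (simp add: Int_absorb1)

lemma param_chart: "c \<in> atlas M \<Longrightarrow> p \<in> fst c \<Longrightarrow> param c (snd c p) = p"
  using chart_inj by (simp add: param_def)

lemma overlap_open:
  assumes "c \<in> atlas M" "d \<in> atlas M"
  shows "open (snd c ` (fst c \<inter> fst d))"
proof -
  have "openin (subtopology (mtop M) (fst c)) (fst c \<inter> fst d)"
    using chart_openin[OF assms(2)] by (auto simp: openin_subtopology)
  then have "openin (top_of_set (snd c ` fst c)) (snd c ` (fst c \<inter> fst d))"
    using homeomorphic_imp_open_map[OF chart_homeomorphic[OF assms(1)]] by (simp add: open_map_def)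
  then show ?thesis using chart_image_open[OF assms(1)] openin_open_trans by blast
qed

lemma transition_der:
  assumes "c \<in> charts_at M p" "d \<in> charts_at M p"
  shows "(snd d \<circ> param c has_derivative frechet_derivative (snd d \<circ> param c) (at (snd c p))) (at (snd c p))"
proof -
  have "smooth_on (snd c ` (fst c \<inter> fst d)) (snd d \<circ> param c)"
    using manifold assms by (simp add: smooth_manifold_def charts_at_def)
  from smooth_on_differentiable[OF this, of "snd c p"] assms show ?thesis
    by (simp add: frechet_derivative_works charts_at_def)
qed

text \<open>The chain rule, since passing through \<open>d\<close> and back does not change
  \<open>param c\<close> on the overlap. It serves both chart transitions and the differential of
  the immersion.\<close>

lemma change_of_chart_der:
  assumes c: "c \<in> charts_at M p" and d: "d \<in> charts_at M p"
    and h: "(h \<circ> param d has_derivative H) (at (snd d p))"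
  shows "(h \<circ> param c has_derivative (\<lambda>v. H (frechet_derivative (snd d \<circ> param c) (at (snd c p)) v)))
    (at (snd c p))"
proof -
  have "(h \<circ> param d has_derivative H) (at ((snd d \<circ> param c) (snd c p)))"
    using h param_chart charts_atD[OF c] by simp
  from has_derivative_compose[OF transition_der[OF c d] this]
  show ?thesis
  proof (rule has_derivative_transform_within_open)
    show "open (snd c ` (fst c \<inter> fst d))" "snd c p \<in> snd c ` (fst c \<inter> fst d)"
      using c d by (auto simp: charts_at_def intro: overlap_open)
    show "(h \<circ> param d) ((snd d \<circ> param c) y) = (h \<circ> param c) y" if "y \<in> snd c ` (fst c \<inter> fst d)" for y
    proof -
      from that obtain q where "y = snd c q" "q \<in> fst c" "q \<in> fst d" by blast
      then show ?thesis by (simp add: param_chart charts_atD(1)[OF c] charts_atD(1)[OF d])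
    qed
  qed
qed

lemma transition_compose:
  assumes "c \<in> charts_at M p" "d \<in> charts_at M p" "e \<in> charts_at M p"
  shows "frechet_derivative (snd e \<circ> param c) (at (snd c p)) v
       = frechet_derivative (snd e \<circ> param d) (at (snd d p)) (frechet_derivative (snd d \<circ> param c) (at (snd c p)) v)"
  using frechet_derivative_at[OF change_of_chart_der[OF assms(1,2) transition_der[OF assms(2,3)]]]
  by metis

lemma transition_self:
  assumes "c \<in> charts_at M p"
  shows "frechet_derivative (snd c \<circ> param c) (at (snd c p)) v = v"
proof -
  note c = charts_atD[OF assms]
  have "y = (snd c \<circ> param c) y" if "y \<in> snd c ` fst c" for y
  proof -
    from that obtain q where "y = snd c q" "q \<in> fst c" by blast
    then show ?thesis by (simp add: param_chart[OF c(1)])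
  qed
  with c have "(snd c \<circ> param c has_derivative (\<lambda>v. v)) (at (snd c p))"
    by (intro has_derivative_transform_within_open[OF has_derivative_ident chart_image_open]) auto
  then show ?thesis using frechet_derivative_at by metis
qed

lemma coord_vector_self: "c \<in> charts_at M p \<Longrightarrow> coord_vector M c p v c = v"
  by (simp add: coord_vector_def transition_self)

lemma coord_vector_in_tangent_space: "c \<in> charts_at M p \<Longrightarrow> coord_vector M c p v \<in> tangent_space M p"
  unfolding tangent_space_def
  by (auto simp only: mem_Collect_eq coord_vector_def if_True if_False intro: transition_compose)

text \<open>With \<open>coord_vector_self\<close>, this identifies the tangent space with the
  Euclidean space of coordinates in \<open>c\<close>.\<close>

lemma coord_vector_of_tangent:
  "c \<in> charts_at M p \<Longrightarrow> u \<in> tangent_space M p \<Longrightarrow> coord_vector M c p (u c) = u"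
proof (rule ext)
  fix d assume c: "c \<in> charts_at M p" and u: "u \<in> tangent_space M p"
  show "coord_vector M c p (u c) d = u d"
  proof (cases "d \<in> charts_at M p")
    case True
    then have "u d = frechet_derivative (snd d \<circ> param c) (at (snd c p)) (u c)"
      using c u unfolding tangent_space_def by blast
    with True show ?thesis by (simp add: coord_vector_def)
  next
    case False
    then have "u d = 0" using u unfolding tangent_space_def by blast
    with False show ?thesis by (simp add: coord_vector_def)
  qed
qed

lemma coord_vector_linear:
  assumes "c \<in> charts_at M p"
  shows "coord_vector M c p (a *\<^sub>R u + b *\<^sub>R v) = (\<lambda>d. a *\<^sub>R coord_vector M c p u d + b *\<^sub>R coord_vector M c p v d)"
  using has_derivative_linear[OF transition_der[OF assms]]
  by (auto simp: coord_vector_def fun_eq_iff linear_add linear_cmul)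

lemma coord_vector_nonzero:
  assumes "c \<in> charts_at M p" "v \<noteq> 0"
  shows "coord_vector M c p v \<noteq> (\<lambda>d. 0)"
  using coord_vector_self[OF assms(1)] assms(2) by metis

end

section \<open>The hyperboloid as a graph\<close>

lemma param_hyperboloid:
  "param (hyperboloid, snd) x = (sqrt (1 + x \<bullet> x), x :: 'h::euclidean_space)"
proof -
  have uniq: "p = (sqrt (1 + x \<bullet> x), x)" if "p \<in> hyperboloid" "snd p = x" for p :: "real \<times> 'h"
  proof -
    have "(fst p)\<^sup>2 = 1 + x \<bullet> x" "fst p > 0"
      using that by (auto simp: hyperboloid_def lorentz_def power2_eq_square)
    then have "fst p = sqrt (1 + x \<bullet> x)" by (simp add: real_sqrt_unique)
    with that show ?thesis by (simp add: prod_eq_iff)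
  qed
  have "(sqrt (1 + x \<bullet> x), x) \<in> hyperboloid"
    by (simp add: hyperboloid_def lorentz_def add_pos_nonneg)
  then have "x \<in> snd ` (hyperboloid :: (real \<times> 'h) set)" by force
  then show ?thesis
    using uniq[of "param (hyperboloid, snd) x"]
    by (simp add: param_def inv_into_into f_inv_into_f)
qed

lemma hyperboloid_eqI: "p \<in> hyperboloid \<Longrightarrow> p = (sqrt (1 + snd p \<bullet> snd p), snd p)"
  by (auto simp: hyperboloid_def lorentz_def prod_eq_iff power2_eq_square intro!: real_sqrt_unique[symmetric])

lemma param_hyperboloid_der:
  "(param (hyperboloid, snd) has_derivative
     frechet_derivative (param (hyperboloid, snd)) (at (x :: 'h::euclidean_space))) (at x)"
proof -
  have "((\<lambda>x. (sqrt (1 + x \<bullet> x), x)) has_derivative (\<lambda>h. ((x \<bullet> h) / sqrt (1 + x \<bullet> x), h))) (at x)"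
    using inner_ge_zero[of x]
    by (auto intro!: derivative_eq_intros simp: inner_commute field_simps add_pos_nonneg)
  then have "param (hyperboloid, snd) differentiable (at x)"
    unfolding differentiable_def param_hyperboloid[abs_def] by blast
  then show ?thesis by (simp add: frechet_derivative_works)
qed

theorem corollary4:
  fixes M :: "('a, 'e::euclidean_space) riemannian"
    and J :: "'a \<Rightarrow> ('a, 'e) tangent \<Rightarrow> ('a, 'e) tangent"
    and n :: nat
  assumes "n \<ge> 2"
    and "DIM('e) = 2 * n"
    and "DIM('h::euclidean_space) = 3 * n - 1"
    and "kaehler_manifold M J"
    and "\<exists>x\<in>topspace (mtop M). \<forall>S\<in>tangent_space M x.
           S \<noteq> (\<lambda>c. 0) \<longrightarrow> sectional_curvature M x S (J x S) > 0"
  shows "\<not> (\<exists>f. isometric_immersion M (hyperbolic_space :: (real \<times> 'h, 'h) riemannian) f)"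
proof

  \<comment> \<open>The hypotheses for points and tangent vectors\<close>
  let ?H = "hyperbolic_space :: (real \<times> 'h, 'h) riemannian"
  let ?d = "(hyperboloid, snd) :: (real \<times> 'h, 'h) chart"
  assume "\<exists>f. isometric_immersion M ?H f"
  then obtain f where f: "isometric_immersion M ?H f" by blast
  obtain p where p: "p \<in> topspace (mtop M)"
    and curv: "\<And>S. S \<in> tangent_space M p \<Longrightarrow> S \<noteq> (\<lambda>c. 0) \<Longrightarrow> sectional_curvature M p S (J p S) > 0"
    using assms(5) by blast
  have riem: "riemannian_manifold M" and acs: "almost_complex_structure M J"
    and orth: "orthogonal_endo M J" and par: "parallel_endo M J"
    using assms(4) by (auto simp: kaehler_manifold_def)
  interpret manifold_charts M
    using riem by unfold_locales (simp add: riemannian_manifold_def)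
  have atlas_H: "atlas ?H = {?d}" and mtop_H: "mtop ?H = top_of_set hyperboloid"
    and metric_H: "metric ?H q u v = lorentz (frechet_derivative (param ?d) (at (snd q)) (u ?d))
        (frechet_derivative (param ?d) (at (snd q)) (v ?d))" for q u v
    by (simp_all add: hyperbolic_space_def Let_def)
  have f_hyp: "f q \<in> hyperboloid" if "q \<in> topspace (mtop M)" for q
    using f that continuous_map_image_subset_topspace[of "mtop M" "mtop ?H" f]
    by (auto simp: isometric_immersion_def smooth_map_def mtop_H)
  have f_smooth: "smooth_on (snd c ` fst c) (snd \<circ> f \<circ> param c)" if "c \<in> atlas M" for c
  proof -
    \<comment> \<open>The chart of hyperbolic space is global, so smoothness holds on the whole
      image of \<open>c\<close>.\<close>
    have "fst c \<inter> f -` hyperboloid = fst c" using f_hyp chart_subset_topspace[OF that] by auto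
    then show ?thesis
      using f that by (auto simp: isometric_immersion_def smooth_map_def atlas_H)
  qed
  have f_der: "(snd \<circ> f \<circ> param c has_derivative frechet_derivative (snd \<circ> f \<circ> param c) (at (snd c q))) (at (snd c q))"
    if "c \<in> charts_at M q" for c q
    using smooth_on_differentiable[OF f_smooth, of c "snd c q"] charts_atD[OF that]
    by (simp add: frechet_derivative_works)
  have J_tangent: "J q u \<in> tangent_space M q" "J q (J q u) = (\<lambda>c. - u c)"
    if "q \<in> topspace (mtop M)" "u \<in> tangent_space M q" for q u
    using acs that by (auto simp: almost_complex_structure_def)
  have J_lin: "J q (\<lambda>c. a *\<^sub>R u c + b *\<^sub>R v c) = (\<lambda>c. a *\<^sub>R J q u c + b *\<^sub>R J q v c)"
    if "q \<in> topspace (mtop M)" "u \<in> tangent_space M q" "v \<in> tangent_space M q" for q u v a b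
    using acs that by (auto simp: almost_complex_structure_def)
  have metric_sym: "metric M q u v = metric M q v u"
    if "q \<in> topspace (mtop M)" "u \<in> tangent_space M q" "v \<in> tangent_space M q" for q u v
    using riem that by (auto simp: riemannian_manifold_def)
  have metric_lin: "metric M q (\<lambda>c. a *\<^sub>R u c + b *\<^sub>R v c) w = a * metric M q u w + b * metric M q v w"
    if "q \<in> topspace (mtop M)" "u \<in> tangent_space M q" "v \<in> tangent_space M q" "w \<in> tangent_space M q" for q u v w a b
    using riem that by (auto simp: riemannian_manifold_def)
  have metric_pos: "metric M q u u > 0"
    if "q \<in> topspace (mtop M)" "u \<in> tangent_space M q" "u \<noteq> (\<lambda>c. 0)" for q u
    using riem that by (auto simp: riemannian_manifold_def)
  have metric_J: "metric M q (J q u) (J q v) = metric M q u v"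
    if "q \<in> topspace (mtop M)" "u \<in> tangent_space M q" "v \<in> tangent_space M q" for q u v
    using orth that by (auto simp: orthogonal_endo_def)

  \<comment> \<open>The immersion in a chart around the point\<close>
  define c where "c = (SOME c. c \<in> charts_at M p)"
  have c: "c \<in> charts_at M p"
    unfolding c_def using charts_at_nonempty[OF p] some_in_eq by blast
  have cA: "c \<in> atlas M" and x_param: "param c (snd c p) = p"
    using charts_atD[OF c] param_chart by auto
  define S where "S = snd c ` fst c"
  define x where "x = snd c p"
  define \<Phi> where "\<Phi> = f \<circ> param c"
  define G where "G = local_metric M c"
  define I where "I = local_endo M J c"
  have S: "open S" "x \<in> S"
    using chart_image_open[OF cA] charts_atD[OF c] by (auto simp: S_def x_def)
  have at: "c \<in> charts_at M (param c y)" "snd c (param c y) = y" "param c y \<in> topspace (mtop M)" if "y \<in> S" for y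
    using that param_chart[OF cA] chart_subset_topspace[OF cA] cA by (auto simp: S_def charts_at_def)
  note tangent = coord_vector_in_tangent_space[OF at(1)]
  have \<Phi>_hyp: "\<Phi> y \<in> hyperboloid" if "y \<in> S" for y
    using f_hyp at(3)[OF that] by (simp add: \<Phi>_def)
  have \<Phi>_eq: "(sqrt (1 + snd (\<Phi> y) \<bullet> snd (\<Phi> y)), snd (\<Phi> y)) = \<Phi> y" if "y \<in> S" for y
    using hyperboloid_eqI[OF \<Phi>_hyp[OF that]] by simp
  \<comment> \<open>Smoothness of \<open>f\<close> concerns its spatial part, the chart coordinate;
    the time component is recovered from it by the square root in the graph formula.\<close>
  have \<Phi>_Ck: "Ck_on k S \<Phi>" for k
  proof -
    have \<psi>: "Ck_on k S (\<lambda>y. snd (\<Phi> y))"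
      using smooth_on_imp_Ck_on[OF f_smooth[OF cA]] by (simp add: S_def \<Phi>_def comp_def)
    then have "Ck_on k S (\<lambda>y. sqrt (1 + snd (\<Phi> y) \<bullet> snd (\<Phi> y)))"
      by (intro Ck_on_sqrt Ck_on_add Ck_on_const Ck_on_bilinear[OF bounded_bilinear_inner] S)
         (simp_all add: add_pos_nonneg)
    with \<psi> have "Ck_on k S (\<lambda>y. sqrt (1 + snd (\<Phi> y) \<bullet> snd (\<Phi> y)) *\<^sub>R (1, 0) + (0, snd (\<Phi> y)))"
      by (intro Ck_on_add S Ck_on_bounded_linear[OF bounded_linear_scaleR_left]
          Ck_on_bounded_linear[of "\<lambda>v. (0, v)"] bounded_linear_Pair bounded_linear_zero bounded_linear_ident)
    then show ?thesis
      by (rule Ck_on_cong[OF S(1), rotated]) (use \<Phi>_eq in simp)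
  qed
  have G_eq: "G y u v = lorentz (frechet_derivative \<Phi> (at y) u) (frechet_derivative \<Phi> (at y) v)"
    if y: "y \<in> S" for y u v
  proof -
    define q where "q = param c y"
    \<comment> \<open>The chart that \<open>differential\<close> selects at \<open>q\<close>, which
      may differ from \<open>c\<close>; the chain rule through \<open>c'\<close> gives the same
      derivative.\<close>
    define c' where "c' = (SOME c. c \<in> charts_at M q)"
    have q: "q \<in> topspace (mtop M)" "c \<in> charts_at M q" "snd c q = y"
      using at[OF y] by (auto simp: q_def)
    have c': "c' \<in> charts_at M q"
      unfolding c'_def using charts_at_nonempty[OF q(1)] some_in_eq by blast
    have d: "?d \<in> charts_at ?H (f q)" using f_hyp[OF q(1)] by (simp add: charts_at_def atlas_H)
    have df: "differential M ?H f q (coord_vector M c q w) ?d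
        = frechet_derivative (snd \<circ> f \<circ> param c) (at y) w" for w
      using fun_cong[OF frechet_derivative_at[OF change_of_chart_der[OF q(2) c' f_der[OF c']]], of w] d c' q(3)
      by (simp add: differential_def coord_vector_def Let_def flip: c'_def)
    have "(param ?d \<circ> (snd \<circ> f \<circ> param c) has_derivative
        frechet_derivative (param ?d) (at (snd (f q))) \<circ> frechet_derivative (snd \<circ> f \<circ> param c) (at y)) (at y)"
    proof (rule diff_chain_at)
      show "(snd \<circ> f \<circ> param c has_derivative frechet_derivative (snd \<circ> f \<circ> param c) (at y)) (at y)"
        using f_der[OF q(2)] q(3) by simp
      show "(param ?d has_derivative frechet_derivative (param ?d) (at (snd (f q)))) (at ((snd \<circ> f \<circ> param c) y))"
        using param_hyperboloid_der by (simp add: q_def)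
    qed
    then have "(\<Phi> has_derivative
        frechet_derivative (param ?d) (at (snd (f q))) \<circ> frechet_derivative (snd \<circ> f \<circ> param c) (at y)) (at y)"
      by (rule has_derivative_transform_within_open[OF _ S(1) y])
         (use \<Phi>_eq in \<open>simp add: param_hyperboloid \<Phi>_def\<close>)
    then have D\<Phi>: "frechet_derivative \<Phi> (at y) w
        = frechet_derivative (param ?d) (at (snd (f q))) (frechet_derivative (snd \<circ> f \<circ> param c) (at y) w)" for w
      using frechet_derivative_at by (metis comp_apply)
    have "G y u v = metric ?H (f q) (differential M ?H f q (coord_vector M c q u)) (differential M ?H f q (coord_vector M c q v))"
      using f q coord_vector_in_tangent_space[OF q(2)]
      by (simp add: G_def local_metric_def isometric_immersion_def flip: q_def)
    then show ?thesis by (simp add: metric_H df D\<Phi>)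
  qed
  have param: "isometric_parametrization lorentz S \<Phi> G"
  proof (intro isometric_parametrization.intro isometric_parametrization_axioms.intro)
    show "G y u u > 0" if "y \<in> S" "u \<noteq> 0" for y u
      using metric_pos[OF at(3)[OF that(1)] tangent[OF that(1)] coord_vector_nonzero[OF at(1)[OF that(1)] that(2)]]
      by (simp add: G_def local_metric_def)
  qed (simp_all add: bounded_bilinear_lorentz lorentz_commute S \<Phi>_Ck G_eq del: Ck_on.simps)

  \<comment> \<open>The pointwise Kaehler and curvature conditions in coordinates\<close>
  have I: "coord_vector M c p (I x u) = J p (coord_vector M c p u)" for u
    using coord_vector_of_tangent[OF c J_tangent(1)[OF p coord_vector_in_tangent_space[OF c]]]
    by (simp add: I_def local_endo_def x_def x_param)
  have Gx: "G x u v = metric M p (coord_vector M c p u) (coord_vector M c p v)" for u v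
    by (simp add: G_def local_metric_def x_def x_param)
  note T = coord_vector_in_tangent_space[OF c]
  have "3 * DIM('e) \<le> 2 * DIM('h)"
  proof (rule kaehler_parametrization_codimension[OF param S(2), of I])
    show "lorentz (\<Phi> y) (\<Phi> y) = - 1" if "y \<in> S" for y
      using \<Phi>_hyp[OF that] by (simp add: hyperboloid_def)
    show "linear (I y)" if "y \<in> S" for y
      using coord_vector_linear[OF at(1)[OF that], of 1 _ 1] coord_vector_linear[OF at(1)[OF that], of _ _ 0]
        J_lin[OF at(3)[OF that] tangent[OF that] tangent[OF that], of 1 _ 1]
        J_lin[OF at(3)[OF that] tangent[OF that] tangent[OF that], of _ _ 0]
      by (intro linearI) (simp_all add: I_def local_endo_def)
    show "(\<lambda>z. I z v) differentiable at y" if "y \<in> S" for y v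
    proof -
      have "smooth_on S (\<lambda>z. I z v)"
        using acs cA unfolding almost_complex_structure_def S_def I_def by blast
      then show ?thesis using that by (rule smooth_on_differentiable)
    qed
    show "frechet_derivative (\<lambda>z. I z v) (at y) u + christoffel G y u (I y v) - I y (christoffel G y u v) = 0"
      if "y \<in> S" for y u v
      using par cA that by (auto simp: parallel_endo_def S_def I_def G_def)
    show "I x (I x u) = - u" for u
    proof -
      have "coord_vector M c p (I x (I x u)) = (\<lambda>d. - coord_vector M c p u d)"
        by (simp add: I J_tangent(2)[OF p T])
      from fun_cong[OF this, of c] show ?thesis by (simp add: coord_vector_self[OF c])
    qed
    show "G x (I x u) (I x v) = G x u v" for u v
      by (simp add: Gx I metric_J[OF p T T])
    show "G x (local_curvature G x u (I x u) (I x u)) u > 0" if "u \<noteq> 0" for u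
    proof -
      let ?S = "coord_vector M c p u"
      have pos: "metric M p ?S ?S > 0"
        using metric_pos[OF p T coord_vector_nonzero[OF c that]] .
      have JS: "J p ?S \<in> tangent_space M p" by (rule J_tangent(1)[OF p T])
      \<comment> \<open>Orthogonality of S and JS reduces the denominator of the sectional curvature
        to |S|^4.\<close>
      have "metric M p ?S (J p ?S) = metric M p (J p ?S) (J p (J p ?S))"
        using metric_J[OF p T JS] by simp
      also have "\<dots> = metric M p (\<lambda>c. - ?S c) (J p ?S)"
        using metric_sym[OF p JS J_tangent(1)[OF p JS]] by (simp add: J_tangent(2)[OF p T])
      also have "\<dots> = - metric M p ?S (J p ?S)"
        using metric_lin[OF p T T JS, of "-1" u 0 u] by simp
      finally have orthS: "metric M p ?S (J p ?S) = 0" by simp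
      \<comment> \<open>\<open>c\<close> is the chart that \<open>curvature\<close> selects at
        \<open>p\<close>, so the definition unfolds directly to coordinates in
        \<open>c\<close>.\<close>
      have "curvature M p ?S (J p ?S) (J p ?S) = coord_vector M c p (local_curvature G x u (I x u) (I x u))"
        by (simp add: curvature_def Let_def coord_vector_self[OF c] I_def local_endo_def G_def x_def x_param
            flip: c_def)
      then have "sectional_curvature M p ?S (J p ?S)
          = G x (local_curvature G x u (I x u) (I x u)) u / (metric M p ?S ?S)\<^sup>2"
        by (simp add: sectional_curvature_def Gx orthS metric_J[OF p T T] power2_eq_square)
      then show ?thesis
        using curv[OF T coord_vector_nonzero[OF c that]] pos by (simp add: zero_less_divide_iff)
    qed
  qed
  \<comment> \<open>The bound reads 6n \<le> 2 (3n - 1), which fails for positive n.\<close>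
  then show False using assms(1-3) by simp
qed

end
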